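(* Let $(A,G,\sigma)$ be a skew category system, and let $A \rtimes^{\sigma} G$ be the associated skew category algebra. Consider the following five assertions: (i) $A \rtimes^{\sigma} G$ is simple; (ii) $G$ is inverse connected; (iii) for each $e \in \mathrm{ob}(G)$, the ring $A_e$ is $G_e$-simple; (iv) for each $e \in \mathrm{ob}(G)$, the ring $Z(A_e \rtimes^{\sigma} G_e)$ is a field; (v) $\ker(\sigma)$ is locally trivial. The following conclusions hold: (a) (i) implies each of (ii), (iii), (iv) and (v); (b) if $G$ is a locally abelian groupoid, then (i) holds if and only if (ii), (iii), (iv) and (v) all hold.
   Context: For a small category $G$: $\mathrm{ob}(G)$ is its set of objects and $\mathrm{mor}(G)$ its set of morphisms; $n \in G$ means $n \in \mathrm{mor}(G)$. An object is identified with its identity morphism. The domain and codomain of a morphism $n$ are $d(n)$ and $c(n)$; the product $mn$ is defined exactly when $d(m)=c(n)$, and $G^{(2)}$ is the set of such composable pairs $(m,n)$. For $e \in \mathrm{ob}(G)$, $G_e$ is the monoid of all $n$ with $d(n)=c(n)=e$. A groupoid is a category all of whose morphisms are isomorphisms. $G$ is locally abelian if each monoid $G_e$ is abelian. $G$ is inverse connected if for all $e,f \in \mathrm{ob}(G)$ there are $m,n \in \mathrm{mor}(G)$ with $d(m)=c(n)=f$ and $mn=e$ (the identity of $e$). Rings are associative; unital rings have nonzero identity, and homomorphisms between unital rings preserve identities. $\mathrm{Ring}$ is the category of unital rings. Ideals are two-sided; a nontrivial ideal is one that is proper and nonzero. A ring is simple if it has no nontrivial ideal. $Z(R)$ is the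 center of $R$. A skew category system is a triple $(A,G,\sigma)$ where $G$ is a small category, $A = \bigoplus_{e \in \mathrm{ob}(G)} A_e$ is a direct sum of unital rings $A_e$, and $\sigma : G \to \mathrm{Ring}$ is a functor with $\sigma(n) : A_{d(n)} \to A_{c(n)}$ for $n \in G$; so $\sigma(e)=\mathrm{id}_{A_e}$ for $e \in \mathrm{ob}(G)$ and $\sigma(m)\sigma(n)=\sigma(mn)$ for $(m,n)\in G^{(2)}$. The skew category algebra $A \rtimes^{\sigma} G$ is the set of formal sums $\sum_{n \in G} a_n u_n$ with $a_n \in A_{c(n)}$, all but finitely many $a_n$ being zero, with componentwise addition and multiplication determined biadditively by $(a u_m)(b u_n) = a\,\sigma(m)(b)\, u_{mn}$ if $(m,n) \in G^{(2)}$ and $(a u_m)(b u_n) = 0$ otherwise. It is an associative ring, not necessarily unital. $A_e \rtimes^{\sigma} G_e$ is the skew category algebra of the one-object category $G_e$ acting on $A_e$ by restriction of $\sigma$. $A_e$ is $G_e$-simple if there is no nontrivial ideal $J$ of $A_e$ with $\sigma(n)(J) \subseteq J$ for all $n \in G_e$. $\ker(\sigma)$ is locally trivial if for each $e \in \mathrm{ob}(G)$ and all $m,n \in G_e$, $\sigma(m)=\sigma(n)$ implies $m=n$. *)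

theory Defs
  imports "HOL-Algebra.RingHom"
begin

section \<open>Small categories\<close>

text \<open>
  Objects are identified with their identity morphisms, so the objects form a subset of the
  morphisms. The product \<open>Comp G m n\<close> is meaningful only if \<open>Dom G m = Cod G n\<close>.
\<close>

record 'g category =
  Obj :: "'g set"
  Mor :: "'g set"
  Dom :: "'g \<Rightarrow> 'g"
  Cod :: "'g \<Rightarrow> 'g"
  Comp :: "'g \<Rightarrow> 'g \<Rightarrow> 'g"

locale small_category =
  fixes G :: "'g category"
  assumes Obj_subset: "Obj G \<subseteq> Mor G"
    and Dom_closed: "n \<in> Mor G \<Longrightarrow> Dom G n \<in> Obj G"
    and Cod_closed: "n \<in> Mor G \<Longrightarrow> Cod G n \<in> Obj G"
    and Dom_Obj: "e \<in> Obj G \<Longrightarrow> Dom G e = e"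
    and Cod_Obj: "e \<in> Obj G \<Longrightarrow> Cod G e = e"
    and Comp_closed:
      "\<lbrakk>m \<in> Mor G; n \<in> Mor G; Dom G m = Cod G n\<rbrakk> \<Longrightarrow> Comp G m n \<in> Mor G"
    and Dom_Comp:
      "\<lbrakk>m \<in> Mor G; n \<in> Mor G; Dom G m = Cod G n\<rbrakk> \<Longrightarrow> Dom G (Comp G m n) = Dom G n"
    and Cod_Comp:
      "\<lbrakk>m \<in> Mor G; n \<in> Mor G; Dom G m = Cod G n\<rbrakk> \<Longrightarrow> Cod G (Comp G m n) = Cod G m"
    and Comp_assoc:
      "\<lbrakk>l \<in> Mor G; m \<in> Mor G; n \<in> Mor G; Dom G l = Cod G m; Dom G m = Cod G n\<rbrakk>
        \<Longrightarrow> Comp G (Comp G l m) n = Comp G l (Comp G m n)"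
    and Comp_Dom: "n \<in> Mor G \<Longrightarrow> Comp G n (Dom G n) = n"
    and Cod_Comp_id: "n \<in> Mor G \<Longrightarrow> Comp G (Cod G n) n = n"

definition local_mor :: "'g category \<Rightarrow> 'g \<Rightarrow> 'g set" where
  "local_mor G e = {n \<in> Mor G. Dom G n = e \<and> Cod G n = e}"

definition local_category :: "'g category \<Rightarrow> 'g \<Rightarrow> 'g category" where
  "local_category G e = G\<lparr>Obj := {e}, Mor := local_mor G e\<rparr>"

definition is_groupoid :: "'g category \<Rightarrow> bool" where
  "is_groupoid G \<longleftrightarrow> small_category G \<and>
     (\<forall>n\<in>Mor G. \<exists>m\<in>Mor G. Dom G m = Cod G n \<and> Cod G m = Dom G n \<and>
        Comp G m n = Dom G n \<and> Comp G n m = Cod G n)"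

definition locally_abelian :: "'g category \<Rightarrow> bool" where
  "locally_abelian G \<longleftrightarrow>
     (\<forall>e\<in>Obj G. \<forall>m\<in>local_mor G e. \<forall>n\<in>local_mor G e. Comp G m n = Comp G n m)"

definition inverse_connected :: "'g category \<Rightarrow> bool" where
  "inverse_connected G \<longleftrightarrow>
     (\<forall>e\<in>Obj G. \<forall>f\<in>Obj G. \<exists>m\<in>Mor G. \<exists>n\<in>Mor G.
        Dom G m = f \<and> Cod G n = f \<and> Comp G m n = e)"


section \<open>Ideals, simplicity and centers\<close>

text \<open>
  The library's \<open>ideal\<close> presupposes a unital ring, whereas skew category algebras need not have an
  identity. The following notion does not refer to an identity and agrees with \<open>ideal\<close> on unital
  rings.
\<close>

definition two_sided_ideal :: "'a set \<Rightarrow> 'a ring \<Rightarrow> bool" where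
  "two_sided_ideal I R \<longleftrightarrow> additive_subgroup I R \<and>
     (\<forall>a\<in>I. \<forall>x\<in>carrier R. x \<otimes>\<^bsub>R\<^esub> a \<in> I \<and> a \<otimes>\<^bsub>R\<^esub> x \<in> I)"

lemma two_sided_ideal_iff_ideal:
  assumes "ring R"
  shows "two_sided_ideal I R \<longleftrightarrow> ideal I R"
  using assms unfolding two_sided_ideal_def ideal_def ideal_axioms_def by blast

definition nontrivial_ideal :: "'a set \<Rightarrow> 'a ring \<Rightarrow> bool" where
  "nontrivial_ideal I R \<longleftrightarrow> two_sided_ideal I R \<and> I \<noteq> carrier R \<and> I \<noteq> {\<zero>\<^bsub>R\<^esub>}"

definition simple_ring :: "'a ring \<Rightarrow> bool" where
  "simple_ring R \<longleftrightarrow> \<not> (\<exists>I. nontrivial_ideal I R)"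

definition center_ring :: "'a ring \<Rightarrow> 'a ring" where
  "center_ring R =
     R\<lparr>carrier := {z \<in> carrier R. \<forall>x\<in>carrier R. z \<otimes>\<^bsub>R\<^esub> x = x \<otimes>\<^bsub>R\<^esub> z}\<rparr>"


section \<open>Skew category systems\<close>

text \<open>
  The direct sum of the rings \<open>A e\<close> is represented by the family \<open>A\<close> of its summands.
\<close>

locale skew_category_system = small_category G
  for A :: "'g \<Rightarrow> 'a ring" and G :: "'g category" and \<sigma> :: "'g \<Rightarrow> 'a \<Rightarrow> 'a" +
  assumes ring_A: "e \<in> Obj G \<Longrightarrow> ring (A e)"
    and one_not_zero_A: "e \<in> Obj G \<Longrightarrow> \<one>\<^bsub>A e\<^esub> \<noteq> \<zero>\<^bsub>A e\<^esub>"
    and \<sigma>_hom: "n \<in> Mor G \<Longrightarrow> \<sigma> n \<in> ring_hom (A (Dom G n)) (A (Cod G n))"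
    and \<sigma>_Obj: "\<lbrakk>e \<in> Obj G; x \<in> carrier (A e)\<rbrakk> \<Longrightarrow> \<sigma> e x = x"
    and \<sigma>_Comp:
      "\<lbrakk>m \<in> Mor G; n \<in> Mor G; Dom G m = Cod G n; x \<in> carrier (A (Dom G n))\<rbrakk>
        \<Longrightarrow> \<sigma> m (\<sigma> n x) = \<sigma> (Comp G m n) x"

text \<open>
  The formal sum of the \<open>f n u\<^sub>n\<close> is the function \<open>f\<close>, taken to be \<open>undefined\<close> outside \<open>Mor G\<close>.
  In a product, the summands with \<open>f m = \<zero>\<close> or \<open>g n = \<zero>\<close> are left out in order to have a
  finite index set. The record field \<open>one\<close> is the identity if \<open>Obj G\<close> is finite; if \<open>Obj G\<close> is
  infinite, it does not belong to the carrier.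
\<close>

definition skew_category_algebra ::
    "('g \<Rightarrow> 'a ring) \<Rightarrow> 'g category \<Rightarrow> ('g \<Rightarrow> 'a \<Rightarrow> 'a) \<Rightarrow> ('g \<Rightarrow> 'a) ring" where
  "skew_category_algebra A G \<sigma> =
    \<lparr>carrier = {f \<in> (\<Pi>\<^sub>E n\<in>Mor G. carrier (A (Cod G n))).
        finite {n \<in> Mor G. f n \<noteq> \<zero>\<^bsub>A (Cod G n)\<^esub>}},
     monoid.mult = (\<lambda>f g. \<lambda>k\<in>Mor G. finsum (A (Cod G k))
        (\<lambda>(m, n). f m \<otimes>\<^bsub>A (Cod G k)\<^esub> \<sigma> m (g n))
        {(m, n). m \<in> Mor G \<and> n \<in> Mor G \<and> Dom G m = Cod G n \<and> Comp G m n = k \<and>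
           f m \<noteq> \<zero>\<^bsub>A (Cod G m)\<^esub> \<and> g n \<noteq> \<zero>\<^bsub>A (Cod G n)\<^esub>}),
     one = (\<lambda>n\<in>Mor G. if n \<in> Obj G then \<one>\<^bsub>A n\<^esub> else \<zero>\<^bsub>A (Cod G n)\<^esub>),
     zero = (\<lambda>n\<in>Mor G. \<zero>\<^bsub>A (Cod G n)\<^esub>),
     add = (\<lambda>f g. \<lambda>n\<in>Mor G. f n \<oplus>\<^bsub>A (Cod G n)\<^esub> g n)\<rparr>"

definition monomial ::
    "('g \<Rightarrow> 'a ring) \<Rightarrow> 'g category \<Rightarrow> 'a \<Rightarrow> 'g \<Rightarrow> 'g \<Rightarrow> 'a" where
  "monomial A G a m = (\<lambda>n\<in>Mor G. if n = m then a else \<zero>\<^bsub>A (Cod G n)\<^esub>)"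

lemma (in skew_category_system) monomial_mult:
  assumes m: "m \<in> Mor G" and n: "n \<in> Mor G"
    and a: "a \<in> carrier (A (Cod G m))" and b: "b \<in> carrier (A (Cod G n))"
  shows "monomial A G a m \<otimes>\<^bsub>skew_category_algebra A G \<sigma>\<^esub> monomial A G b n =
    (if Dom G m = Cod G n
     then monomial A G (a \<otimes>\<^bsub>A (Cod G m)\<^esub> \<sigma> m b) (Comp G m n)
     else \<zero>\<^bsub>skew_category_algebra A G \<sigma>\<^esub>)"
proof -
  let ?S = "\<lambda>k. {(p, q). p \<in> Mor G \<and> q \<in> Mor G \<and> Dom G p = Cod G q \<and> Comp G p q = k \<and>
           monomial A G a m p \<noteq> \<zero>\<^bsub>A (Cod G p)\<^esub> \<and> monomial A G b n q \<noteq> \<zero>\<^bsub>A (Cod G q)\<^esub>}"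
  let ?h = "\<lambda>k. finsum (A (Cod G k))
      (\<lambda>(p, q). monomial A G a m p \<otimes>\<^bsub>A (Cod G k)\<^esub> \<sigma> p (monomial A G b n q)) (?S k)"
  have S: "?S k = (if Dom G m = Cod G n \<and> Comp G m n = k \<and>
      a \<noteq> \<zero>\<^bsub>A (Cod G m)\<^esub> \<and> b \<noteq> \<zero>\<^bsub>A (Cod G n)\<^esub> then {(m, n)} else {})" for k
    using m n by (auto simp: monomial_def split: if_splits)
  have ring: "ring (A (Cod G k))" if "k \<in> Mor G" for k
    using that Cod_closed ring_A by blast
  have h: "?h k = (if Dom G m = Cod G n \<and> k = Comp G m n
      then a \<otimes>\<^bsub>A (Cod G m)\<^esub> \<sigma> m b else \<zero>\<^bsub>A (Cod G k)\<^esub>)" if k: "k \<in> Mor G" for k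
  proof (cases "Dom G m = Cod G n \<and> k = Comp G m n")
    case True
    then have c: "Cod G k = Cod G m" and d: "Dom G m = Cod G n" and kk: "k = Comp G m n"
      using Cod_Comp m n by auto
    interpret M: ring "A (Cod G m)" using ring m by blast
    have hom: "\<sigma> m \<in> ring_hom (A (Cod G n)) (A (Cod G m))" using \<sigma>_hom[OF m] d by simp
    then have sb: "\<sigma> m b \<in> carrier (A (Cod G m))" using b by (simp add: ring_hom_closed)
    have s0: "\<sigma> m \<zero>\<^bsub>A (Cod G n)\<^esub> = \<zero>\<^bsub>A (Cod G m)\<^esub>"
      using ring_hom_zero[OF hom ring[OF n] ring[OF m]] .
    show ?thesis
    proof (cases "a \<noteq> \<zero>\<^bsub>A (Cod G m)\<^esub> \<and> b \<noteq> \<zero>\<^bsub>A (Cod G n)\<^esub>")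
      case nz: True
      have "?S k = {(m, n)}" unfolding S using nz True by auto
      then have "?h k = finsum (A (Cod G m))
          (\<lambda>(p, q). monomial A G a m p \<otimes>\<^bsub>A (Cod G m)\<^esub> \<sigma> p (monomial A G b n q)) {(m, n)}"
        using c by simp
      also have "\<dots> = a \<otimes>\<^bsub>A (Cod G m)\<^esub> \<sigma> m b"
        using m n a sb by (simp add: M.finsum_insert monomial_def)
      finally show ?thesis using True by simp
    next
      case z: False
      then have "?S k = {}" unfolding S by auto
      then have "?h k = \<zero>\<^bsub>A (Cod G m)\<^esub>" by (simp only: c M.finsum_empty)
      moreover have "a \<otimes>\<^bsub>A (Cod G m)\<^esub> \<sigma> m b = \<zero>\<^bsub>A (Cod G m)\<^esub>"
        using z a sb s0 by auto
      ultimately show ?thesis using True by (simp only: if_True simp_thms)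
    qed
  next
    case False
    then have Sk: "?S k = {}" unfolding S by auto
    interpret K: ring "A (Cod G k)" using ring k by blast
    from Sk show ?thesis using False by (simp only: K.finsum_empty if_False)
  qed
  have "monomial A G a m \<otimes>\<^bsub>skew_category_algebra A G \<sigma>\<^esub> monomial A G b n = restrict ?h (Mor G)"
    by (simp add: skew_category_algebra_def)
  also have "\<dots> = (\<lambda>k\<in>Mor G. if Dom G m = Cod G n \<and> k = Comp G m n
      then a \<otimes>\<^bsub>A (Cod G m)\<^esub> \<sigma> m b else \<zero>\<^bsub>A (Cod G k)\<^esub>)"
    by (rule restrict_ext) (rule h)
  also have "\<dots> = (if Dom G m = Cod G n
     then monomial A G (a \<otimes>\<^bsub>A (Cod G m)\<^esub> \<sigma> m b) (Comp G m n)
     else \<zero>\<^bsub>skew_category_algebra A G \<sigma>\<^esub>)"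
    by (rule ext) (simp add: monomial_def skew_category_algebra_def)
  finally show ?thesis .
qed

definition locally_simple ::
    "('g \<Rightarrow> 'a ring) \<Rightarrow> 'g category \<Rightarrow> ('g \<Rightarrow> 'a \<Rightarrow> 'a) \<Rightarrow> 'g \<Rightarrow> bool" where
  "locally_simple A G \<sigma> e \<longleftrightarrow>
     \<not> (\<exists>J. nontrivial_ideal J (A e) \<and> (\<forall>n\<in>local_mor G e. \<sigma> n ` J \<subseteq> J))"

text \<open>
  The values of \<open>\<sigma>\<close> are homomorphisms, so they are compared on the domain ring only.
\<close>

definition kernel_locally_trivial ::
    "('g \<Rightarrow> 'a ring) \<Rightarrow> 'g category \<Rightarrow> ('g \<Rightarrow> 'a \<Rightarrow> 'a) \<Rightarrow> bool" where
  "kernel_locally_trivial A G \<sigma> \<longleftrightarrow>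
     (\<forall>e\<in>Obj G. \<forall>m\<in>local_mor G e. \<forall>n\<in>local_mor G e.
        (\<forall>x\<in>carrier (A e). \<sigma> m x = \<sigma> n x) \<longrightarrow> m = n)"

end

theory Submission
  imports Defs
begin

text \<open>
  Write \<open>R\<close> for the skew category algebra and \<open>u\<^sub>n\<close> for the monomial with coefficient one at a
  morphism \<open>n\<close>. For an object \<open>e\<close>, the element \<open>u\<^sub>e\<close> is idempotent, and the corner
  \<open>u\<^sub>e R u\<^sub>e\<close> is the skew monoid ring \<open>A\<^sub>e \<rtimes> G\<^sub>e\<close>, which is unital. The whole argument compares
  \<open>R\<close> with these corners.

  Assume that \<open>R\<close> is simple. If \<open>L\<close> is a nontrivial ideal of a corner, then the elements \<open>f\<close> with
  \<open>u\<^sub>e R f R u\<^sub>e \<subseteq> L\<close> form an ideal of \<open>R\<close> that contains \<open>L\<close> but not \<open>u\<^sub>e\<close>; hence all corners are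
  simple (\<open>simple_corner_if_simple\<close>). The three local conclusions are then statements about a simple
  skew monoid ring. An ideal \<open>J\<close> of \<open>A\<^sub>e\<close> that \<open>G\<^sub>e\<close> maps into itself gives the ideal of all elements
  with coefficients in \<open>J\<close> (\<open>locally_simple_if_simple\<close>). A nonzero central element of a simple
  unital ring generates the whole ring and is therefore invertible (\<open>field_center_ring_if_simple\<close>).
  The ring acts on \<open>A\<^sub>e\<close> by \<open>(a u\<^sub>n) \<cdot> x = a \<sigma>\<^sub>n(x)\<close>, the annihilator of this module is a proper
  ideal, and it contains \<open>u\<^sub>m - u\<^sub>n\<close> whenever \<open>\<sigma>\<^sub>m = \<sigma>\<^sub>n\<close> (\<open>kernel_locally_trivial_if_simple\<close>).
  The category is inverse connected because the elements supported on the morphisms that factor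
  through an object \<open>f\<close> form a nonzero ideal, which must contain \<open>u\<^sub>e\<close>
  (\<open>inverse_connected_if_simple\<close>).

  For the converse let \<open>G\<close> be a locally abelian groupoid. A nonzero ideal of \<open>R\<close> meets some corner:
  multiply a nonzero element by \<open>u\<^sub>n\<close> for a suitable isomorphism \<open>n\<close> in order to move a nonzero
  coefficient to an identity. If corners are simple, the ideal thus contains some \<open>u\<^sub>h\<close>, and by inverse
  connectedness it contains every \<open>u\<^sub>e\<close>, so it is all of \<open>R\<close> (\<open>simple_if_simple_corners\<close>). A corner
  is a skew group ring of an abelian group (\<open>simple_if_abelian_group\<close>). There, among the nonzero
  elements of an ideal, take one of minimal support with the identity in its support. Since the group
  is abelian, the coefficients at the identity that occur without enlarging this support form an
  invariant ideal of \<open>A\<^sub>e\<close>; by \<open>G\<^sub>e\<close>-simplicity the coefficient can be made \<open>1\<close>. The commutators of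
  the resulting element \<open>x\<close> with coefficients, and the differences \<open>u\<^sub>m x u\<^sub>m\<^sup>-\<^sup>1 - x\<close>, have smaller
  support and hence vanish. So \<open>x\<close> is a nonzero element of the center, which is a field, and the ideal
  contains a unit.
\<close>


section \<open>The ring structure of a skew category algebra\<close>

context skew_category_system
begin

abbreviation R where "R \<equiv> skew_category_algebra A G \<sigma>"

abbreviation B where "B n \<equiv> A (Cod G n)"

definition supp :: "('g \<Rightarrow> 'a) \<Rightarrow> 'g set" where
  "supp f = {n \<in> Mor G. f n \<noteq> \<zero>\<^bsub>B n\<^esub>}"

lemma ring_B: "n \<in> Mor G \<Longrightarrow> ring (B n)"
  using Cod_closed ring_A by blast

lemma Obj_Mor: "e \<in> Obj G \<Longrightarrow> e \<in> Mor G"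
  using Obj_subset by blast

lemma \<sigma>_closed: "\<lbrakk>n \<in> Mor G; x \<in> carrier (A (Dom G n))\<rbrakk> \<Longrightarrow> \<sigma> n x \<in> carrier (B n)"
  using \<sigma>_hom by (blast intro: ring_hom_closed)

lemma \<sigma>_zero: "n \<in> Mor G \<Longrightarrow> \<sigma> n \<zero>\<^bsub>A (Dom G n)\<^esub> = \<zero>\<^bsub>B n\<^esub>"
  using ring_hom_zero[OF \<sigma>_hom ring_A ring_B] Dom_closed by blast

lemma \<sigma>_one: "n \<in> Mor G \<Longrightarrow> \<sigma> n \<one>\<^bsub>A (Dom G n)\<^esub> = \<one>\<^bsub>B n\<^esub>"
  using ring_hom_one[OF \<sigma>_hom] by blast

lemma \<sigma>_add:
  "\<lbrakk>n \<in> Mor G; x \<in> carrier (A (Dom G n)); y \<in> carrier (A (Dom G n))\<rbrakk>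
    \<Longrightarrow> \<sigma> n (x \<oplus>\<^bsub>A (Dom G n)\<^esub> y) = \<sigma> n x \<oplus>\<^bsub>B n\<^esub> \<sigma> n y"
  using ring_hom_add[OF \<sigma>_hom] by blast

lemma \<sigma>_mult:
  "\<lbrakk>n \<in> Mor G; x \<in> carrier (A (Dom G n)); y \<in> carrier (A (Dom G n))\<rbrakk>
    \<Longrightarrow> \<sigma> n (x \<otimes>\<^bsub>A (Dom G n)\<^esub> y) = \<sigma> n x \<otimes>\<^bsub>B n\<^esub> \<sigma> n y"
  using ring_hom_mult[OF \<sigma>_hom] by blast

lemma carrier_iff:
  "f \<in> carrier R \<longleftrightarrow> f \<in> extensional (Mor G) \<and> (\<forall>n\<in>Mor G. f n \<in> carrier (B n)) \<and> finite (supp f)"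
  by (auto simp: skew_category_algebra_def supp_def PiE_def)

lemma coeff_closed: "\<lbrakk>f \<in> carrier R; n \<in> Mor G\<rbrakk> \<Longrightarrow> f n \<in> carrier (B n)"
  by (simp add: carrier_iff)

lemma finite_supp: "f \<in> carrier R \<Longrightarrow> finite (supp f)"
  by (simp add: carrier_iff)

lemma supp_subset: "supp f \<subseteq> Mor G"
  by (auto simp: supp_def)

lemma coeff_eqI:
  assumes "f \<in> carrier R" "g \<in> carrier R" "\<And>n. n \<in> Mor G \<Longrightarrow> f n = g n"
  shows "f = g"
  using assms extensionalityI[of f "Mor G" g] by (simp add: carrier_iff)

lemma coeff_zero: "n \<in> Mor G \<Longrightarrow> \<zero>\<^bsub>R\<^esub> n = \<zero>\<^bsub>B n\<^esub>"
  by (simp add: skew_category_algebra_def)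

lemma coeff_add: "n \<in> Mor G \<Longrightarrow> (f \<oplus>\<^bsub>R\<^esub> g) n = f n \<oplus>\<^bsub>B n\<^esub> g n"
  by (simp add: skew_category_algebra_def)

lemma zero_closed: "\<zero>\<^bsub>R\<^esub> \<in> carrier R"
  using ring_B by (auto simp: skew_category_algebra_def ring.ring_simprules)

lemma add_closed:
  assumes "f \<in> carrier R" "g \<in> carrier R"
  shows "f \<oplus>\<^bsub>R\<^esub> g \<in> carrier R"
proof -
  have "supp (f \<oplus>\<^bsub>R\<^esub> g) \<subseteq> supp f \<union> supp g"
    using ring_B by (auto simp: supp_def coeff_add ring.ring_simprules)
  then have "finite (supp (f \<oplus>\<^bsub>R\<^esub> g))"
    using assms by (meson finite_UnI finite_subset finite_supp)
  moreover have "f \<oplus>\<^bsub>R\<^esub> g \<in> extensional (Mor G)"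
    by (simp add: skew_category_algebra_def)
  ultimately show ?thesis
    using assms ring_B by (auto simp: carrier_iff coeff_add ring.ring_simprules)
qed

lemma neg_closed:
  assumes "f \<in> carrier R"
  shows "(\<lambda>n\<in>Mor G. \<ominus>\<^bsub>B n\<^esub> f n) \<in> carrier R"
proof -
  have "supp (\<lambda>n\<in>Mor G. \<ominus>\<^bsub>B n\<^esub> f n) \<subseteq> supp f"
    using ring_B assms by (auto simp: supp_def ring.ring_simprules coeff_closed)
  then show ?thesis
    using assms ring_B finite_subset
    by (auto simp: carrier_iff ring.ring_simprules)
qed

lemma abelian_group_R: "abelian_group R"
proof (rule abelian_groupI)
  fix f g h assume c: "f \<in> carrier R" "g \<in> carrier R" "h \<in> carrier R"
  show "f \<oplus>\<^bsub>R\<^esub> g \<oplus>\<^bsub>R\<^esub> h = f \<oplus>\<^bsub>R\<^esub> (g \<oplus>\<^bsub>R\<^esub> h)"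
    by (rule coeff_eqI)
      (use c ring_B in \<open>auto simp: add_closed coeff_add ring.ring_simprules coeff_closed\<close>)
next
  fix f g assume c: "f \<in> carrier R" "g \<in> carrier R"
  show "f \<oplus>\<^bsub>R\<^esub> g = g \<oplus>\<^bsub>R\<^esub> f"
    by (rule coeff_eqI)
      (use c ring_B in \<open>auto simp: add_closed coeff_add ring.ring_simprules coeff_closed\<close>)
next
  fix f assume c: "f \<in> carrier R"
  show "\<zero>\<^bsub>R\<^esub> \<oplus>\<^bsub>R\<^esub> f = f"
    by (rule coeff_eqI)
      (use c ring_B in \<open>auto simp: add_closed zero_closed coeff_add coeff_zero ring.ring_simprules coeff_closed\<close>)
  have "(\<lambda>n\<in>Mor G. \<ominus>\<^bsub>B n\<^esub> f n) \<oplus>\<^bsub>R\<^esub> f = \<zero>\<^bsub>R\<^esub>"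
    by (rule coeff_eqI)
      (use c ring_B in \<open>auto simp: add_closed zero_closed neg_closed coeff_add coeff_zero
        ring.ring_simprules coeff_closed\<close>)
  then show "\<exists>g\<in>carrier R. g \<oplus>\<^bsub>R\<^esub> f = \<zero>\<^bsub>R\<^esub>"
    using neg_closed[OF c] by blast
qed (auto simp: zero_closed add_closed)

sublocale R: abelian_group R
  by (rule abelian_group_R)

lemma coeff_neg:
  assumes f: "f \<in> carrier R" and n: "n \<in> Mor G"
  shows "(\<ominus>\<^bsub>R\<^esub> f) n = \<ominus>\<^bsub>B n\<^esub> f n"
proof -
  interpret n: ring "B n" using ring_B n .
  have "(\<ominus>\<^bsub>R\<^esub> f) n \<oplus>\<^bsub>B n\<^esub> f n = \<zero>\<^bsub>B n\<^esub>"
    using R.l_neg[OF f] coeff_add[OF n] coeff_zero[OF n] by metis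
  then show ?thesis
    using f n by (simp add: coeff_closed n.minus_equality)
qed

lemma coeff_monomial:
  "n \<in> Mor G \<Longrightarrow> monomial A G a m n = (if n = m then a else \<zero>\<^bsub>B n\<^esub>)"
  by (simp add: monomial_def)

lemma monomial_closed:
  assumes "m \<in> Mor G" "a \<in> carrier (B m)"
  shows "monomial A G a m \<in> carrier R"
proof -
  have "supp (monomial A G a m) \<subseteq> {m}"
    by (auto simp: supp_def coeff_monomial split: if_splits)
  then have "finite (supp (monomial A G a m))"
    using finite_subset by blast
  then show ?thesis
    using assms ring_B
    by (auto simp: carrier_iff coeff_monomial ring.ring_simprules) (simp add: monomial_def)
qed

lemma supp_eq_empty:
  assumes f: "f \<in> carrier R" and supp: "supp f = {}"
  shows "f = \<zero>\<^bsub>R\<^esub>"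
proof (rule coeff_eqI)
  show "f n = \<zero>\<^bsub>R\<^esub> n" if "n \<in> Mor G" for n
    using supp that by (auto simp: coeff_zero supp_def)
qed (rule f, rule zero_closed)

text \<open>
  Elements are finite sums of monomials. Identities that are additive in each argument therefore need
  to be checked on monomials only; associativity and multiplicativity are proved in this way below.
\<close>

lemma carrier_induct [consumes 1, case_names zero monomial add]:
  assumes f: "f \<in> carrier R"
    and zero: "P \<zero>\<^bsub>R\<^esub>"
    and monomial: "\<And>a m. \<lbrakk>m \<in> Mor G; a \<in> carrier (B m)\<rbrakk> \<Longrightarrow> P (monomial A G a m)"
    and add: "\<And>f g. \<lbrakk>f \<in> carrier R; g \<in> carrier R; P f; P g\<rbrakk> \<Longrightarrow> P (f \<oplus>\<^bsub>R\<^esub> g)"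
  shows "P f"
  using f
proof (induction "card (supp f)" arbitrary: f rule: less_induct)
  case less
  show ?case
  proof (cases "supp f = {}")
    case True
    then show ?thesis using supp_eq_empty[OF less.prems] zero by simp
  next
    case False
    then obtain m where m: "m \<in> supp f" by blast
    then have mM: "m \<in> Mor G" using supp_subset by blast
    define g where "g = f(m := \<zero>\<^bsub>B m\<^esub>)"
    have sg: "supp g = supp f - {m}"
      by (auto simp: g_def supp_def)
    have g: "g \<in> carrier R"
      using less.prems mM ring_B unfolding carrier_iff sg
      by (auto simp: g_def extensional_def ring.ring_simprules)
    have "card (supp g) < card (supp f)"
      unfolding sg using m less.prems by (meson card_Diff1_less finite_supp)
    then have "P g" using less.hyps g by blast
    moreover have fm: "monomial A G (f m) m \<in> carrier R"
      by (rule monomial_closed[OF mM coeff_closed[OF less.prems mM]])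
    moreover have "P (monomial A G (f m) m)"
      by (rule monomial[OF mM coeff_closed[OF less.prems mM]])
    moreover have "f = monomial A G (f m) m \<oplus>\<^bsub>R\<^esub> g"
    proof (rule coeff_eqI)
      show "monomial A G (f m) m \<oplus>\<^bsub>R\<^esub> g \<in> carrier R"
        by (rule add_closed[OF fm g])
      show "f n = (monomial A G (f m) m \<oplus>\<^bsub>R\<^esub> g) n" if n: "n \<in> Mor G" for n
      proof -
        interpret n: ring "B n" using ring_B n .
        show ?thesis
          using n.r_zero[OF coeff_closed[OF less.prems n]] n.l_zero[OF coeff_closed[OF less.prems n]] n
          by (auto simp: coeff_add coeff_monomial g_def)
      qed
    qed (rule less.prems)
    ultimately show ?thesis
      using add[OF fm g] by simp
  qed
qed

text \<open>
  The index set in the definition of a product depends on the supports of the factors. For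
  distributivity, the coefficients of several products must be sums over one common index set.
\<close>

lemma coeff_mult:
  assumes f: "f \<in> carrier R" and g: "g \<in> carrier R" and k: "k \<in> Mor G"
    and F: "finite F" "supp f \<subseteq> F" "F \<subseteq> Mor G" and H: "finite H" "supp g \<subseteq> H" "H \<subseteq> Mor G"
  shows "(f \<otimes>\<^bsub>R\<^esub> g) k = finsum (B k) (\<lambda>(m, n). f m \<otimes>\<^bsub>B k\<^esub> \<sigma> m (g n))
      {(m, n). m \<in> F \<and> n \<in> H \<and> Dom G m = Cod G n \<and> Comp G m n = k}"
proof -
  interpret k: ring "B k" using ring_B k .
  let ?h = "\<lambda>(m, n). f m \<otimes>\<^bsub>B k\<^esub> \<sigma> m (g n)"
  let ?T = "{(m, n). m \<in> F \<and> n \<in> H \<and> Dom G m = Cod G n \<and> Comp G m n = k}"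
  let ?S = "{(m, n). m \<in> Mor G \<and> n \<in> Mor G \<and> Dom G m = Cod G n \<and> Comp G m n = k \<and>
           f m \<noteq> \<zero>\<^bsub>B m\<^esub> \<and> g n \<noteq> \<zero>\<^bsub>B n\<^esub>}"
  have *: "Cod G m = Cod G k" "f m \<in> carrier (B k)" "\<sigma> m (g n) \<in> carrier (B k)"
      "\<sigma> m \<zero>\<^bsub>B n\<^esub> = \<zero>\<^bsub>B k\<^esub>"
    if "m \<in> F" "n \<in> H" "Dom G m = Cod G n" "Comp G m n = k" for m n
  proof -
    have mn: "m \<in> Mor G" "n \<in> Mor G" using that F H by auto
    show c: "Cod G m = Cod G k" using that mn Cod_Comp by metis
    show "f m \<in> carrier (B k)" using coeff_closed[OF f mn(1)] c by simp
    show "\<sigma> m (g n) \<in> carrier (B k)"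
      using \<sigma>_closed[OF mn(1)] coeff_closed[OF g mn(2)] c that by simp
    show "\<sigma> m \<zero>\<^bsub>B n\<^esub> = \<zero>\<^bsub>B k\<^esub>" using \<sigma>_zero[OF mn(1)] c that by simp
  qed
  have "finite ?T"
    by (rule finite_subset[of _ "F \<times> H"]) (use F H in auto)
  moreover have "?S \<subseteq> ?T" using F H by (auto simp: supp_def)
  moreover have "?h p = \<zero>\<^bsub>B k\<^esub>" if "p \<in> ?T - ?S" for p
  proof -
    obtain m n where p: "p = (m, n)" by fastforce
    have mn: "m \<in> F" "n \<in> H" "Dom G m = Cod G n" "Comp G m n = k" using that p by auto
    have "f m = \<zero>\<^bsub>B m\<^esub> \<or> g n = \<zero>\<^bsub>B n\<^esub>" using that p mn F H by auto
    then show ?thesis using *[OF mn] p by auto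
  qed
  moreover have "?h \<in> ?T \<rightarrow> carrier (B k)"
  proof
    fix p assume "p \<in> ?T"
    then show "?h p \<in> carrier (B k)"
      using *(2,3)[of "fst p" "snd p"] by (simp add: split_beta)
  qed
  ultimately have "finsum (B k) ?h ?S = finsum (B k) ?h ?T"
    by (intro k.add.finprod_mono_neutral_cong_left) auto
  then show ?thesis using k by (simp add: skew_category_algebra_def)
qed

lemma supp_mult:
  assumes f: "f \<in> carrier R" and g: "g \<in> carrier R" and k: "k \<in> supp (f \<otimes>\<^bsub>R\<^esub> g)"
  shows "\<exists>m\<in>supp f. \<exists>n\<in>supp g. Dom G m = Cod G n \<and> Comp G m n = k"
proof -
  have kM: "k \<in> Mor G" using k supp_subset by blast
  interpret k: ring "B k" using ring_B kM .
  have "{(m, n). m \<in> supp f \<and> n \<in> supp g \<and> Dom G m = Cod G n \<and> Comp G m n = k} \<noteq> {}"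
  proof
    assume e: "{(m, n). m \<in> supp f \<and> n \<in> supp g \<and> Dom G m = Cod G n \<and> Comp G m n = k} = {}"
    have "(f \<otimes>\<^bsub>R\<^esub> g) k = \<zero>\<^bsub>B k\<^esub>"
      unfolding coeff_mult[OF f g kM finite_supp[OF f] order_refl supp_subset finite_supp[OF g]
          order_refl supp_subset] e by (rule k.finsum_empty)
    then show False using k by (simp add: supp_def)
  qed
  then show ?thesis by blast
qed

lemma mult_closed:
  assumes f: "f \<in> carrier R" and g: "g \<in> carrier R"
  shows "f \<otimes>\<^bsub>R\<^esub> g \<in> carrier R"
proof -
  have "supp (f \<otimes>\<^bsub>R\<^esub> g) \<subseteq> (\<lambda>(m, n). Comp G m n) ` (supp f \<times> supp g)"
  proof
    fix k assume "k \<in> supp (f \<otimes>\<^bsub>R\<^esub> g)"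
    then obtain m n where "m \<in> supp f" "n \<in> supp g" "Comp G m n = k"
      using supp_mult[OF f g] by blast
    then show "k \<in> (\<lambda>(m, n). Comp G m n) ` (supp f \<times> supp g)"
      by (intro image_eqI[where x = "(m, n)"]) auto
  qed
  then have "finite (supp (f \<otimes>\<^bsub>R\<^esub> g))"
    using finite_supp f g by (meson finite_SigmaI finite_imageI finite_subset)
  moreover have "(f \<otimes>\<^bsub>R\<^esub> g) k \<in> carrier (B k)" if k: "k \<in> Mor G" for k
  proof -
    interpret k: ring "B k" using ring_B k .
    have "f m \<otimes>\<^bsub>B k\<^esub> \<sigma> m (g n) \<in> carrier (B k)"
      if "m \<in> supp f" "n \<in> supp g" "Dom G m = Cod G n" "Comp G m n = k" for m n
    proof -
      have mn: "m \<in> Mor G" "n \<in> Mor G" using that supp_subset by auto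
      have "Cod G m = Cod G k" using that mn Cod_Comp by metis
      then show ?thesis
        using coeff_closed[OF f mn(1)] \<sigma>_closed[OF mn(1)] coeff_closed[OF g mn(2)] that by simp
    qed
    then show ?thesis
      unfolding coeff_mult[OF f g k finite_supp[OF f] order_refl supp_subset finite_supp[OF g]
          order_refl supp_subset]
      by (intro k.finsum_closed) auto
  qed
  moreover have "f \<otimes>\<^bsub>R\<^esub> g \<in> extensional (Mor G)"
    by (simp add: skew_category_algebra_def)
  ultimately show ?thesis by (simp add: carrier_iff)
qed

lemma r_distr:
  assumes f: "f \<in> carrier R" and g: "g \<in> carrier R" and h: "h \<in> carrier R"
  shows "f \<otimes>\<^bsub>R\<^esub> (g \<oplus>\<^bsub>R\<^esub> h) = f \<otimes>\<^bsub>R\<^esub> g \<oplus>\<^bsub>R\<^esub> f \<otimes>\<^bsub>R\<^esub> h"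
proof (rule coeff_eqI)
  fix k assume k: "k \<in> Mor G"
  interpret k: ring "B k" using ring_B k .
  let ?H = "supp g \<union> supp h"
  define T where "T = {(m, n). m \<in> supp f \<and> n \<in> ?H \<and> Dom G m = Cod G n \<and> Comp G m n = k}"
  have gh: "g \<oplus>\<^bsub>R\<^esub> h \<in> carrier R" using g h add_closed by blast
  have sub: "supp (g \<oplus>\<^bsub>R\<^esub> h) \<subseteq> ?H"
    using ring_B by (auto simp: supp_def coeff_add ring.ring_simprules)
  have fin: "finite ?H" and H: "?H \<subseteq> Mor G"
    using finite_supp supp_subset g h by auto
  have *: "f m \<in> carrier (B k)" "\<sigma> m (g n) \<in> carrier (B k)" "\<sigma> m (h n) \<in> carrier (B k)"
      "\<sigma> m ((g \<oplus>\<^bsub>R\<^esub> h) n) = \<sigma> m (g n) \<oplus>\<^bsub>B k\<^esub> \<sigma> m (h n)" if "(m, n) \<in> T" for m n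
  proof -
    have mn: "m \<in> Mor G" "n \<in> Mor G" and d: "Dom G m = Cod G n" "Comp G m n = k"
      using that supp_subset by (auto simp: T_def)
    then have c: "Cod G m = Cod G k" using Cod_Comp by metis
    show "f m \<in> carrier (B k)" using coeff_closed[OF f mn(1)] c by simp
    show "\<sigma> m (g n) \<in> carrier (B k)" "\<sigma> m (h n) \<in> carrier (B k)"
      "\<sigma> m ((g \<oplus>\<^bsub>R\<^esub> h) n) = \<sigma> m (g n) \<oplus>\<^bsub>B k\<^esub> \<sigma> m (h n)"
      using \<sigma>_closed[OF mn(1)] \<sigma>_add[OF mn(1)] coeff_closed[OF g mn(2)] coeff_closed[OF h mn(2)] c d
      by (simp_all add: coeff_add mn)
  qed
  have "(f \<otimes>\<^bsub>R\<^esub> (g \<oplus>\<^bsub>R\<^esub> h)) k = finsum (B k) (\<lambda>(m, n). f m \<otimes>\<^bsub>B k\<^esub> \<sigma> m ((g \<oplus>\<^bsub>R\<^esub> h) n)) T"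
    unfolding T_def by (rule coeff_mult[OF f gh k finite_supp[OF f] order_refl supp_subset fin sub H])
  also have "\<dots> = finsum (B k) (\<lambda>p. (case p of (m, n) \<Rightarrow> f m \<otimes>\<^bsub>B k\<^esub> \<sigma> m (g n)) \<oplus>\<^bsub>B k\<^esub>
      (case p of (m, n) \<Rightarrow> f m \<otimes>\<^bsub>B k\<^esub> \<sigma> m (h n))) T"
    by (rule k.finsum_cong') (use * in \<open>auto simp: k.r_distr\<close>)
  also have "\<dots> = finsum (B k) (\<lambda>(m, n). f m \<otimes>\<^bsub>B k\<^esub> \<sigma> m (g n)) T \<oplus>\<^bsub>B k\<^esub>
      finsum (B k) (\<lambda>(m, n). f m \<otimes>\<^bsub>B k\<^esub> \<sigma> m (h n)) T"
    by (rule k.finsum_addf) (use * in auto)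
  also have "\<dots> = (f \<otimes>\<^bsub>R\<^esub> g) k \<oplus>\<^bsub>B k\<^esub> (f \<otimes>\<^bsub>R\<^esub> h) k"
    using coeff_mult[OF f g k finite_supp[OF f] order_refl supp_subset fin _ H]
      coeff_mult[OF f h k finite_supp[OF f] order_refl supp_subset fin _ H] unfolding T_def by simp
  finally show "(f \<otimes>\<^bsub>R\<^esub> (g \<oplus>\<^bsub>R\<^esub> h)) k = (f \<otimes>\<^bsub>R\<^esub> g \<oplus>\<^bsub>R\<^esub> f \<otimes>\<^bsub>R\<^esub> h) k"
    using k by (simp add: coeff_add)
qed (use assms in \<open>auto intro: mult_closed add_closed\<close>)

lemma l_distr:
  assumes f: "f \<in> carrier R" and g: "g \<in> carrier R" and h: "h \<in> carrier R"
  shows "(g \<oplus>\<^bsub>R\<^esub> h) \<otimes>\<^bsub>R\<^esub> f = g \<otimes>\<^bsub>R\<^esub> f \<oplus>\<^bsub>R\<^esub> h \<otimes>\<^bsub>R\<^esub> f"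
proof (rule coeff_eqI)
  fix k assume k: "k \<in> Mor G"
  interpret k: ring "B k" using ring_B k .
  let ?H = "supp g \<union> supp h"
  define T where "T = {(m, n). m \<in> ?H \<and> n \<in> supp f \<and> Dom G m = Cod G n \<and> Comp G m n = k}"
  have gh: "g \<oplus>\<^bsub>R\<^esub> h \<in> carrier R" using g h add_closed by blast
  have sub: "supp (g \<oplus>\<^bsub>R\<^esub> h) \<subseteq> ?H"
    using ring_B by (auto simp: supp_def coeff_add ring.ring_simprules)
  have fin: "finite ?H" and H: "?H \<subseteq> Mor G"
    using finite_supp supp_subset g h by auto
  have *: "\<sigma> m (f n) \<in> carrier (B k)" "g m \<in> carrier (B k)" "h m \<in> carrier (B k)"
      "(g \<oplus>\<^bsub>R\<^esub> h) m = g m \<oplus>\<^bsub>B k\<^esub> h m" if "(m, n) \<in> T" for m n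
  proof -
    have mn: "m \<in> Mor G" "n \<in> Mor G" and d: "Dom G m = Cod G n" "Comp G m n = k"
      using that supp_subset by (auto simp: T_def)
    then have c: "Cod G m = Cod G k" using Cod_Comp by metis
    show "\<sigma> m (f n) \<in> carrier (B k)"
      using \<sigma>_closed[OF mn(1)] coeff_closed[OF f mn(2)] c d by simp
    show "g m \<in> carrier (B k)" "h m \<in> carrier (B k)" "(g \<oplus>\<^bsub>R\<^esub> h) m = g m \<oplus>\<^bsub>B k\<^esub> h m"
      using coeff_closed[OF g mn(1)] coeff_closed[OF h mn(1)] c by (simp_all add: coeff_add mn)
  qed
  have "((g \<oplus>\<^bsub>R\<^esub> h) \<otimes>\<^bsub>R\<^esub> f) k = finsum (B k) (\<lambda>(m, n). (g \<oplus>\<^bsub>R\<^esub> h) m \<otimes>\<^bsub>B k\<^esub> \<sigma> m (f n)) T"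
    unfolding T_def by (rule coeff_mult[OF gh f k fin sub H finite_supp[OF f] order_refl supp_subset])
  also have "\<dots> = finsum (B k) (\<lambda>p. (case p of (m, n) \<Rightarrow> g m \<otimes>\<^bsub>B k\<^esub> \<sigma> m (f n)) \<oplus>\<^bsub>B k\<^esub>
      (case p of (m, n) \<Rightarrow> h m \<otimes>\<^bsub>B k\<^esub> \<sigma> m (f n))) T"
    by (rule k.finsum_cong') (use * in \<open>auto simp: k.l_distr\<close>)
  also have "\<dots> = finsum (B k) (\<lambda>(m, n). g m \<otimes>\<^bsub>B k\<^esub> \<sigma> m (f n)) T \<oplus>\<^bsub>B k\<^esub>
      finsum (B k) (\<lambda>(m, n). h m \<otimes>\<^bsub>B k\<^esub> \<sigma> m (f n)) T"
    by (rule k.finsum_addf) (use * in auto)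
  also have "\<dots> = (g \<otimes>\<^bsub>R\<^esub> f) k \<oplus>\<^bsub>B k\<^esub> (h \<otimes>\<^bsub>R\<^esub> f) k"
    using coeff_mult[OF g f k fin _ H finite_supp[OF f] order_refl supp_subset]
      coeff_mult[OF h f k fin _ H finite_supp[OF f] order_refl supp_subset] unfolding T_def by simp
  finally show "((g \<oplus>\<^bsub>R\<^esub> h) \<otimes>\<^bsub>R\<^esub> f) k = (g \<otimes>\<^bsub>R\<^esub> f \<oplus>\<^bsub>R\<^esub> h \<otimes>\<^bsub>R\<^esub> f) k"
    using k by (simp add: coeff_add)
qed (use assms in \<open>auto intro: mult_closed add_closed\<close>)

lemma mult_zero [simp]:
  assumes f: "f \<in> carrier R"
  shows "f \<otimes>\<^bsub>R\<^esub> \<zero>\<^bsub>R\<^esub> = \<zero>\<^bsub>R\<^esub>" "\<zero>\<^bsub>R\<^esub> \<otimes>\<^bsub>R\<^esub> f = \<zero>\<^bsub>R\<^esub>"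
  using r_distr[OF f R.zero_closed R.zero_closed] l_distr[OF f R.zero_closed R.zero_closed]
    mult_closed[OF f R.zero_closed] mult_closed[OF R.zero_closed f]
  by (simp_all add: R.add.l_cancel_one')

lemma monomial_mult_assoc:
  assumes l: "l \<in> Mor G" "a \<in> carrier (B l)" and m: "m \<in> Mor G" "b \<in> carrier (B m)"
    and n: "n \<in> Mor G" "c \<in> carrier (B n)"
  shows "monomial A G a l \<otimes>\<^bsub>R\<^esub> monomial A G b m \<otimes>\<^bsub>R\<^esub> monomial A G c n =
    monomial A G a l \<otimes>\<^bsub>R\<^esub> (monomial A G b m \<otimes>\<^bsub>R\<^esub> monomial A G c n)"
proof -
  interpret l: ring "B l" using ring_B l by blast
  interpret m: ring "B m" using ring_B m by blast
  have lm: "Comp G l m \<in> Mor G" "Cod G (Comp G l m) = Cod G l" "Dom G (Comp G l m) = Dom G m"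
      "\<sigma> l b \<in> carrier (B l)" "a \<otimes>\<^bsub>B l\<^esub> \<sigma> l b \<in> carrier (B l)" if "Dom G l = Cod G m"
    using that assms Comp_closed Cod_Comp Dom_Comp \<sigma>_closed[OF l(1), of b] by auto
  have mn: "Comp G m n \<in> Mor G" "Cod G (Comp G m n) = Cod G m" "Dom G (Comp G m n) = Dom G n"
      "\<sigma> m c \<in> carrier (B m)" "b \<otimes>\<^bsub>B m\<^esub> \<sigma> m c \<in> carrier (B m)" if "Dom G m = Cod G n"
    using that assms Comp_closed Cod_Comp Dom_Comp \<sigma>_closed[OF m(1), of c] by auto
  have ac: "a \<otimes>\<^bsub>B l\<^esub> \<sigma> l b \<otimes>\<^bsub>B l\<^esub> \<sigma> (Comp G l m) c = a \<otimes>\<^bsub>B l\<^esub> \<sigma> l (b \<otimes>\<^bsub>B m\<^esub> \<sigma> m c)"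
    if d: "Dom G l = Cod G m" "Dom G m = Cod G n"
  proof -
    have "\<sigma> (Comp G l m) c = \<sigma> l (\<sigma> m c)" using \<sigma>_Comp[of l m c] assms d by simp
    then show ?thesis
      using \<sigma>_mult[OF l(1), of b "\<sigma> m c"] \<sigma>_closed[OF l(1)] m n lm mn d l by (simp add: l.m_assoc)
  qed
  show ?thesis
  proof (cases "Dom G l = Cod G m")
    case lmc: True
    show ?thesis
    proof (cases "Dom G m = Cod G n")
      case True
      then show ?thesis
        using lmc assms by (simp add: monomial_mult lm mn ac Comp_assoc)
    next
      case False
      then show ?thesis
        using lmc assms by (simp add: monomial_mult lm monomial_closed)
    qed
  next
    case False
    then show ?thesis
      using assms by (simp add: monomial_mult mn monomial_closed)
  qed
qed

lemma mult_assoc: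
  assumes f: "f \<in> carrier R" and g: "g \<in> carrier R" and h: "h \<in> carrier R"
  shows "f \<otimes>\<^bsub>R\<^esub> g \<otimes>\<^bsub>R\<^esub> h = f \<otimes>\<^bsub>R\<^esub> (g \<otimes>\<^bsub>R\<^esub> h)"
  using f
proof (induction rule: carrier_induct)
  case (monomial a l)
  note l = monomial_closed[OF monomial]
  show ?case
    using g
  proof (induction rule: carrier_induct)
    case (monomial b m)
    note m = monomial_closed[OF monomial]
    show ?case
      using h
    proof (induction rule: carrier_induct)
      case (monomial c n)
      show ?case
        by (rule monomial_mult_assoc) fact+
    qed (use l m in \<open>simp_all add: mult_closed r_distr\<close>)
  qed (use l h in \<open>simp_all add: mult_closed r_distr l_distr\<close>)
qed (use g h in \<open>simp_all add: mult_closed l_distr\<close>)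

lemma ideal_carrier: "\<lbrakk>two_sided_ideal I R; f \<in> I\<rbrakk> \<Longrightarrow> f \<in> carrier R"
  unfolding two_sided_ideal_def using additive_subgroup.a_subset by blast

lemma ideal_mult:
  assumes "two_sided_ideal I R" "f \<in> I" "x \<in> carrier R"
  shows "x \<otimes>\<^bsub>R\<^esub> f \<in> I" "f \<otimes>\<^bsub>R\<^esub> x \<in> I"
  using assms unfolding two_sided_ideal_def by blast+

lemma two_sided_idealI:
  assumes "I \<subseteq> carrier R" "\<zero>\<^bsub>R\<^esub> \<in> I"
    and "\<And>f g. \<lbrakk>f \<in> I; g \<in> I\<rbrakk> \<Longrightarrow> f \<oplus>\<^bsub>R\<^esub> g \<in> I"
    and "\<And>f. f \<in> I \<Longrightarrow> \<ominus>\<^bsub>R\<^esub> f \<in> I"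
    and "\<And>f x. \<lbrakk>f \<in> I; x \<in> carrier R\<rbrakk> \<Longrightarrow> x \<otimes>\<^bsub>R\<^esub> f \<in> I"
    and "\<And>f x. \<lbrakk>f \<in> I; x \<in> carrier R\<rbrakk> \<Longrightarrow> f \<otimes>\<^bsub>R\<^esub> x \<in> I"
  shows "two_sided_ideal I R"
proof -
  have "subgroup I (add_monoid R)"
    by (rule R.add.subgroupI) (use assms in \<open>auto simp: a_inv_def\<close>)
  then show ?thesis
    using assms by (simp add: two_sided_ideal_def additive_subgroup_def)
qed


section \<open>Identities of objects and invertible morphisms\<close>

abbreviation unit where "unit e \<equiv> monomial A G \<one>\<^bsub>A e\<^esub> e"

lemma unit_closed: "e \<in> Obj G \<Longrightarrow> unit e \<in> carrier R"
  using ring_A Obj_Mor Cod_Obj by (simp add: monomial_closed ring.ring_simprules)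

lemma unit_nonzero: "e \<in> Obj G \<Longrightarrow> unit e \<noteq> \<zero>\<^bsub>R\<^esub>"
  using coeff_zero[of e] coeff_monomial[of e "\<one>\<^bsub>A e\<^esub>" e] one_not_zero_A[of e] Obj_Mor[of e] Cod_Obj[of e]
  by auto

lemma unit_mult_monomial:
  assumes e: "e \<in> Obj G" and n: "n \<in> Mor G" "a \<in> carrier (B n)"
  shows "unit e \<otimes>\<^bsub>R\<^esub> monomial A G a n = (if Cod G n = e then monomial A G a n else \<zero>\<^bsub>R\<^esub>)"
  using monomial_mult[of e n "\<one>\<^bsub>A e\<^esub>" a] assms Obj_Mor[OF e] Cod_Obj[OF e] Dom_Obj[OF e] ring_A[OF e]
    \<sigma>_Obj[OF e, of a] Cod_Comp_id[OF n(1)]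
  by (auto simp: ring.ring_simprules)

lemma monomial_mult_unit:
  assumes e: "e \<in> Obj G" and n: "n \<in> Mor G" "a \<in> carrier (B n)"
  shows "monomial A G a n \<otimes>\<^bsub>R\<^esub> unit e = (if Dom G n = e then monomial A G a n else \<zero>\<^bsub>R\<^esub>)"
  using monomial_mult[of n e a "\<one>\<^bsub>A e\<^esub>"] assms Obj_Mor[OF e] Cod_Obj[OF e] Dom_Obj[OF e] ring_A[OF e]
    \<sigma>_one[OF n(1)] Comp_Dom[OF n(1)] ring.ring_simprules(6)[OF ring_A[OF e]] monoid.r_one[OF ring.is_monoid[OF ring_B[OF n(1)]] n(2)]
  by auto

text \<open>
  The algebra has no identity if there are infinitely many objects. The identities of the objects are
  enough, because \<open>a u\<^sub>n = u\<^sub>c (a u\<^sub>n)\<close> for the codomain \<open>c\<close> of \<open>n\<close>.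
\<close>

lemma ideal_eq_carrier:
  assumes I: "two_sided_ideal I R" and u: "\<And>e. e \<in> Obj G \<Longrightarrow> unit e \<in> I"
  shows "I = carrier R"
proof
  interpret I: additive_subgroup I R using I by (simp add: two_sided_ideal_def)
  show "I \<subseteq> carrier R" by (rule I.a_subset)
  show "carrier R \<subseteq> I"
  proof
    fix f assume "f \<in> carrier R"
    then show "f \<in> I"
    proof (induction rule: carrier_induct)
      case (monomial a m)
      have "unit (Cod G m) \<otimes>\<^bsub>R\<^esub> monomial A G a m \<in> I"
        using I u monomial Cod_closed monomial_closed by (simp add: two_sided_ideal_def)
      then show ?case
        using unit_mult_monomial[OF Cod_closed monomial] monomial by simp
    qed auto
  qed
qed

definition inverse_pair :: "'g \<Rightarrow> 'g \<Rightarrow> bool" where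
  "inverse_pair p q \<longleftrightarrow> p \<in> Mor G \<and> q \<in> Mor G \<and> Dom G p = Cod G q \<and> Cod G p = Dom G q \<and>
     Comp G p q = Cod G p \<and> Comp G q p = Dom G p"

text \<open>
  If \<open>p\<close> is invertible, then every \<open>k\<close> has exactly one factorization with \<open>p\<close> as its last (or first)
  factor, so only one summand contributes to a coefficient of the product.
\<close>

lemma coeff_mult_monomial:
  assumes f: "f \<in> carrier R" and pq: "inverse_pair p q" and b: "b \<in> carrier (B p)"
    and k: "k \<in> Mor G" "Dom G k = Dom G p"
  shows "(f \<otimes>\<^bsub>R\<^esub> monomial A G b p) k = f (Comp G k q) \<otimes>\<^bsub>B k\<^esub> \<sigma> (Comp G k q) b"
proof -
  interpret k: ring "B k" using ring_B k by blast
  note pq' = pq[unfolded inverse_pair_def]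
  define m where "m = Comp G k q"
  have m: "m \<in> Mor G" "Cod G m = Cod G k" "Dom G m = Cod G p"
    using pq' k Comp_closed Cod_Comp Dom_Comp by (auto simp: m_def)
  have mp: "Comp G m p = k"
    using Comp_assoc[of k q p] pq' k Comp_Dom[of k] by (simp add: m_def)
  have uniq: "l = m" if "l \<in> Mor G" "Dom G l = Cod G p" "Comp G l p = k" for l
    using Comp_assoc[of l p q] pq' that Comp_Dom[of l] m_def by simp
  let ?T = "{(l, n). l \<in> insert m (supp f) \<and> n \<in> {p} \<and> Dom G l = Cod G n \<and> Comp G l n = k}"
  have T: "?T = {(m, p)}"
    using m mp by (auto dest: uniq subsetD[OF supp_subset])
  have cl: "f m \<otimes>\<^bsub>B k\<^esub> \<sigma> m b \<in> carrier (B k)"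
    using coeff_closed[OF f m(1)] \<sigma>_closed[OF m(1)] b m by simp
  have "(f \<otimes>\<^bsub>R\<^esub> monomial A G b p) k =
      finsum (B k) (\<lambda>(m, n). f m \<otimes>\<^bsub>B k\<^esub> \<sigma> m (monomial A G b p n)) ?T"
    by (rule coeff_mult)
      (use f pq' b k m supp_subset finite_supp monomial_closed in
        \<open>auto simp: supp_def coeff_monomial split: if_splits\<close>)
  also have "\<dots> = f m \<otimes>\<^bsub>B k\<^esub> \<sigma> m b"
    unfolding T using cl pq' by (simp add: coeff_monomial k.finsum_singleton)
  finally show ?thesis unfolding m_def .
qed

lemma coeff_monomial_mult:
  assumes f: "f \<in> carrier R" and pq: "inverse_pair p q" and a: "a \<in> carrier (B p)"
    and k: "k \<in> Mor G" "Cod G k = Cod G p"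
  shows "(monomial A G a p \<otimes>\<^bsub>R\<^esub> f) k = a \<otimes>\<^bsub>B k\<^esub> \<sigma> p (f (Comp G q k))"
proof -
  interpret k: ring "B k" using ring_B k by blast
  note pq' = pq[unfolded inverse_pair_def]
  define n where "n = Comp G q k"
  have n: "n \<in> Mor G" "Cod G n = Dom G p"
    using pq' k Comp_closed Cod_Comp by (auto simp: n_def)
  have pn: "Comp G p n = k"
    using Comp_assoc[of p q k] pq' k Cod_Comp_id[of k] by (simp add: n_def)
  have uniq: "l = n" if "l \<in> Mor G" "Dom G p = Cod G l" "Comp G p l = k" for l
    using Comp_assoc[of q p l] pq' that Cod_Comp_id[of l] n_def by simp
  let ?T = "{(m, l). m \<in> {p} \<and> l \<in> insert n (supp f) \<and> Dom G m = Cod G l \<and> Comp G m l = k}"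
  have T: "?T = {(p, n)}"
    using n pn by (auto dest: uniq subsetD[OF supp_subset])
  have cl: "a \<otimes>\<^bsub>B k\<^esub> \<sigma> p (f n) \<in> carrier (B k)"
    using coeff_closed[OF f n(1)] \<sigma>_closed[of p "f n"] pq' a n k by (intro k.m_closed) simp_all
  have "(monomial A G a p \<otimes>\<^bsub>R\<^esub> f) k =
      finsum (B k) (\<lambda>(m, n). monomial A G a p m \<otimes>\<^bsub>B k\<^esub> \<sigma> m (f n)) ?T"
    by (rule coeff_mult)
      (use f pq' a k n supp_subset finite_supp monomial_closed in
        \<open>auto simp: supp_def coeff_monomial split: if_splits\<close>)
  also have "\<dots> = a \<otimes>\<^bsub>B k\<^esub> \<sigma> p (f n)"
    unfolding T using cl pq' by (simp add: coeff_monomial k.finsum_singleton)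
  finally show ?thesis unfolding n_def .
qed


section \<open>Inverse connectedness\<close>

text \<open>
  The morphisms that factor through \<open>f\<close> are closed under composition with arbitrary morphisms, so the
  elements supported on them form an ideal. It contains \<open>u\<^sub>f\<close>; if it is everything, it contains \<open>u\<^sub>e\<close>,
  and the identity of \<open>e\<close> factors through \<open>f\<close>.
\<close>

lemma inverse_connected_if_simple:
  assumes simple: "simple_ring R"
  shows "inverse_connected G"
  unfolding inverse_connected_def
proof (intro ballI)
  fix e f assume e: "e \<in> Obj G" and f: "f \<in> Obj G"
  define N where "N = {k \<in> Mor G. \<exists>m\<in>Mor G. \<exists>n\<in>Mor G. Dom G m = f \<and> Cod G n = f \<and> Comp G m n = k}"
  have N_left: "Comp G p k \<in> N" if "k \<in> N" "p \<in> Mor G" "Dom G p = Cod G k" for p k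
  proof -
    obtain m n where mn: "m \<in> Mor G" "n \<in> Mor G" "Dom G m = f" "Cod G n = f" "Comp G m n = k"
      using \<open>k \<in> N\<close> by (auto simp: N_def)
    have "Cod G k = Cod G m" using mn Cod_Comp by metis
    then have "Comp G (Comp G p m) n = Comp G p k" "Comp G p m \<in> Mor G" "Dom G (Comp G p m) = f"
      "Comp G p k \<in> Mor G"
      using mn that Comp_assoc[of p m n] Comp_closed Dom_Comp[of p m] by (auto simp: N_def)
    then show ?thesis using mn unfolding N_def by blast
  qed
  have N_right: "Comp G k p \<in> N" if "k \<in> N" "p \<in> Mor G" "Dom G k = Cod G p" for p k
  proof -
    obtain m n where mn: "m \<in> Mor G" "n \<in> Mor G" "Dom G m = f" "Cod G n = f" "Comp G m n = k"
      using \<open>k \<in> N\<close> by (auto simp: N_def)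
    have "Dom G k = Dom G n" using mn Dom_Comp by metis
    then have "Comp G m (Comp G n p) = Comp G k p" "Comp G n p \<in> Mor G" "Cod G (Comp G n p) = f"
      "Comp G k p \<in> Mor G"
      using mn that Comp_assoc[of m n p] Comp_closed Cod_Comp[of n p] by (auto simp: N_def)
    then show ?thesis using mn unfolding N_def by blast
  qed
  define I where "I = {x \<in> carrier R. supp x \<subseteq> N}"
  have "two_sided_ideal I R"
  proof (rule two_sided_idealI)
    fix x y assume xy: "x \<in> I" "y \<in> carrier R"
    show "y \<otimes>\<^bsub>R\<^esub> x \<in> I"
      using xy supp_mult[of y x] N_left supp_subset mult_closed unfolding I_def by blast
    show "x \<otimes>\<^bsub>R\<^esub> y \<in> I"
      using xy supp_mult[of x y] N_right supp_subset mult_closed unfolding I_def by blast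
  next
    fix x y assume xy: "x \<in> I" "y \<in> I"
    have "supp (x \<oplus>\<^bsub>R\<^esub> y) \<subseteq> supp x \<union> supp y"
      using ring_B by (auto simp: supp_def coeff_add ring.ring_simprules)
    then show "x \<oplus>\<^bsub>R\<^esub> y \<in> I" using xy by (auto simp: I_def)
  next
    fix x assume x: "x \<in> I"
    have "supp (\<ominus>\<^bsub>R\<^esub> x) \<subseteq> supp x"
      using x ring_B by (auto simp: supp_def coeff_neg ring.ring_simprules I_def)
    then show "\<ominus>\<^bsub>R\<^esub> x \<in> I" using x by (auto simp: I_def)
  qed (auto simp: I_def supp_def coeff_zero)
  moreover have "f \<in> N"
    using f Obj_Mor[OF f] Dom_Obj[OF f] Cod_Obj[OF f] Comp_Dom[of f] by (auto simp: N_def)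
  then have "unit f \<in> I"
    using unit_closed[OF f] by (auto simp: I_def supp_def coeff_monomial split: if_splits)
  then have "I \<noteq> {\<zero>\<^bsub>R\<^esub>}" using unit_nonzero[OF f] by blast
  ultimately have "I = carrier R"
    using simple by (auto simp: simple_ring_def nontrivial_ideal_def)
  then have "unit e \<in> I" using unit_closed[OF e] by simp
  moreover have "e \<in> supp (unit e)"
    using e Obj_Mor[OF e] Cod_Obj[OF e] one_not_zero_A[OF e] by (simp add: supp_def coeff_monomial)
  ultimately have "e \<in> N" unfolding I_def by blast
  then show "\<exists>m\<in>Mor G. \<exists>n\<in>Mor G. Dom G m = f \<and> Cod G n = f \<and> Comp G m n = e"
    by (auto simp: N_def)
qed

end


section \<open>Centers of simple rings\<close>

text \<open>
  For a central \<open>z \<noteq> 0\<close> the set \<open>z R\<close> is a nonzero two-sided ideal, so it contains \<open>1\<close>. The inverse of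
  a central element is central.
\<close>

lemma field_center_ring_if_simple:
  fixes R :: "'a ring"
  assumes R: "ring R" and nz: "\<one>\<^bsub>R\<^esub> \<noteq> \<zero>\<^bsub>R\<^esub>" and simple: "simple_ring R"
  shows "field (center_ring R)"
proof -
  interpret ring R by (rule R)
  let ?Z = "center_ring R"
  have ZI: "z \<in> carrier ?Z" if "z \<in> carrier R" "\<And>x. x \<in> carrier R \<Longrightarrow> z \<otimes>\<^bsub>R\<^esub> x = x \<otimes>\<^bsub>R\<^esub> z" for z
    using that by (simp add: center_ring_def)
  have ZR: "z \<in> carrier R" if "z \<in> carrier ?Z" for z
    using that by (simp add: center_ring_def)
  have ZC: "z \<otimes>\<^bsub>R\<^esub> x = x \<otimes>\<^bsub>R\<^esub> z" if "z \<in> carrier ?Z" "x \<in> carrier R" for z x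
    using that by (simp add: center_ring_def)
  have ops [simp]: "\<zero>\<^bsub>?Z\<^esub> = \<zero>\<^bsub>R\<^esub>" "\<one>\<^bsub>?Z\<^esub> = \<one>\<^bsub>R\<^esub>" "x \<oplus>\<^bsub>?Z\<^esub> y = x \<oplus>\<^bsub>R\<^esub> y" "x \<otimes>\<^bsub>?Z\<^esub> y = x \<otimes>\<^bsub>R\<^esub> y"
    for x y by (simp_all add: center_ring_def)
  have cring: "cring ?Z"
  proof (rule cringI)
    show "abelian_group ?Z"
    proof (rule abelian_groupI)
      fix x assume x: "x \<in> carrier ?Z"
      then have "\<ominus>\<^bsub>R\<^esub> x \<in> carrier ?Z" "\<ominus>\<^bsub>R\<^esub> x \<oplus>\<^bsub>R\<^esub> x = \<zero>\<^bsub>R\<^esub>"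
        by (auto simp: ZR ZC l_minus r_minus l_neg intro!: ZI)
      then show "\<exists>y\<in>carrier ?Z. y \<oplus>\<^bsub>?Z\<^esub> x = \<zero>\<^bsub>?Z\<^esub>" by auto
    next
      fix x y assume "x \<in> carrier ?Z" "y \<in> carrier ?Z"
      then show "x \<oplus>\<^bsub>?Z\<^esub> y \<in> carrier ?Z"
        unfolding ops by (intro ZI) (simp_all add: ZR ZC l_distr r_distr)
    qed (auto simp: ZR a_ac intro: ZI)
    show "comm_monoid ?Z"
    proof (rule comm_monoidI)
      fix x y assume xy: "x \<in> carrier ?Z" "y \<in> carrier ?Z"
      have "x \<otimes>\<^bsub>R\<^esub> y \<otimes>\<^bsub>R\<^esub> w = w \<otimes>\<^bsub>R\<^esub> (x \<otimes>\<^bsub>R\<^esub> y)" if w: "w \<in> carrier R" for w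
        using xy w ZR ZC by (metis m_assoc)
      then show "x \<otimes>\<^bsub>?Z\<^esub> y \<in> carrier ?Z"
        unfolding ops using xy by (intro ZI) (simp_all add: ZR)
      show "x \<otimes>\<^bsub>?Z\<^esub> y = y \<otimes>\<^bsub>?Z\<^esub> x"
        using xy ZC ZR by simp
    qed (auto simp: ZR m_assoc intro: ZI)
  qed (auto simp: ZR l_distr)
  interpret Z: cring ?Z by (rule cring)
  have "z \<in> Units ?Z" if z: "z \<in> carrier ?Z" "z \<noteq> \<zero>\<^bsub>R\<^esub>" for z
  proof -
    note zR = ZR[OF z(1)] and zc = ZC[OF z(1)]
    define I where "I = (\<lambda>x. z \<otimes>\<^bsub>R\<^esub> x) ` carrier R"
    have "two_sided_ideal I R"
      unfolding two_sided_ideal_def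
    proof (intro conjI ballI)
      have "subgroup I (add_monoid R)"
      proof (rule add.subgroupI)
        fix a b assume "a \<in> I" "b \<in> I"
        then obtain x y where "x \<in> carrier R" "a = z \<otimes>\<^bsub>R\<^esub> x" "y \<in> carrier R" "b = z \<otimes>\<^bsub>R\<^esub> y"
          by (auto simp: I_def)
        then show "a \<oplus>\<^bsub>R\<^esub> b \<in> I"
          unfolding I_def using zR by (intro image_eqI[where x = "x \<oplus>\<^bsub>R\<^esub> y"]) (simp_all add: r_distr)
      next
        fix a assume "a \<in> I"
        then obtain x where "x \<in> carrier R" "a = z \<otimes>\<^bsub>R\<^esub> x"
          by (auto simp: I_def)
        then show "\<ominus>\<^bsub>R\<^esub> a \<in> I"
          unfolding I_def using zR by (intro image_eqI[where x = "\<ominus>\<^bsub>R\<^esub> x"]) (simp_all add: r_minus)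
      qed (use zR in \<open>auto simp: I_def\<close>)
      then show "additive_subgroup I R" by (simp add: additive_subgroup_def)
    next
      fix a x assume a: "a \<in> I" and x: "x \<in> carrier R"
      then obtain y where y: "y \<in> carrier R" "a = z \<otimes>\<^bsub>R\<^esub> y" by (auto simp: I_def)
      have "x \<otimes>\<^bsub>R\<^esub> a = z \<otimes>\<^bsub>R\<^esub> (x \<otimes>\<^bsub>R\<^esub> y)"
        using zc[OF x] x y zR by (simp add: m_assoc[symmetric])
      then show "x \<otimes>\<^bsub>R\<^esub> a \<in> I" using x y by (auto simp: I_def)
      show "a \<otimes>\<^bsub>R\<^esub> x \<in> I" using x y zR by (auto simp: I_def m_assoc)
    qed
    moreover have "z \<in> I" using zR by (auto simp: I_def intro: image_eqI[where x = "\<one>\<^bsub>R\<^esub>"])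
    ultimately have "I = carrier R"
      using simple z(2) by (auto simp: simple_ring_def nontrivial_ideal_def)
    then have "\<one>\<^bsub>R\<^esub> \<in> I" by simp
    then obtain y where y: "y \<in> carrier R" "z \<otimes>\<^bsub>R\<^esub> y = \<one>\<^bsub>R\<^esub>" by (auto simp: I_def)
    have yz: "y \<otimes>\<^bsub>R\<^esub> z = \<one>\<^bsub>R\<^esub>" using zc y by metis
    have "y \<otimes>\<^bsub>R\<^esub> x = x \<otimes>\<^bsub>R\<^esub> y" if x: "x \<in> carrier R" for x
    proof -
      have "y \<otimes>\<^bsub>R\<^esub> x = y \<otimes>\<^bsub>R\<^esub> (x \<otimes>\<^bsub>R\<^esub> z) \<otimes>\<^bsub>R\<^esub> y" using x y zR by (simp add: m_assoc)
      also have "\<dots> = y \<otimes>\<^bsub>R\<^esub> (z \<otimes>\<^bsub>R\<^esub> x) \<otimes>\<^bsub>R\<^esub> y" using zc[OF x] by simp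
      also have "\<dots> = (y \<otimes>\<^bsub>R\<^esub> z) \<otimes>\<^bsub>R\<^esub> x \<otimes>\<^bsub>R\<^esub> y" using x y zR by (simp add: m_assoc)
      also have "\<dots> = x \<otimes>\<^bsub>R\<^esub> y" using x yz by simp
      finally show ?thesis .
    qed
    then have "y \<in> carrier ?Z" using y by (intro ZI)
    then show ?thesis using z y yz by (auto simp: Units_def)
  qed
  moreover have "\<zero>\<^bsub>R\<^esub> \<notin> Units ?Z"
    using nz ZR by (auto simp: Units_def)
  ultimately have "Units ?Z = carrier ?Z - {\<zero>\<^bsub>?Z\<^esub>}"
    by (auto simp: Units_def)
  then show ?thesis by (rule Z.cring_fieldI)
qed


section \<open>Simple skew monoid rings\<close>

lemma finsum_in_additive_subgroup:
  assumes "abelian_group M" and J: "additive_subgroup J M" and h: "\<And>x. x \<in> F \<Longrightarrow> h x \<in> J"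
  shows "finsum M h F \<in> J"
proof -
  interpret M: abelian_group M by fact
  interpret J: additive_subgroup J M by fact
  from h show ?thesis
  proof (induction F rule: infinite_finite_induct)
    case (insert x F)
    then have "finsum M h (insert x F) = h x \<oplus>\<^bsub>M\<^esub> finsum M h F"
      using J.a_subset by (intro M.finsum_insert) auto
    then show ?case using insert J.a_closed by simp
  qed (auto simp: M.finsum_infinite)
qed

text \<open>
  A category with one object is a monoid, and \<open>R\<close> is then a skew monoid ring over \<open>A e\<close>.
\<close>

locale skew_monoid_system = skew_category_system A G \<sigma>
  for A :: "'g \<Rightarrow> 'a ring" and G :: "'g category" and \<sigma> :: "'g \<Rightarrow> 'a \<Rightarrow> 'a" +
  fixes e :: 'g
  assumes Obj_eq: "Obj G = {e}"
begin

lemma Dom_eq [simp]: "n \<in> Mor G \<Longrightarrow> Dom G n = e"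
  using Dom_closed Obj_eq by auto

lemma Cod_eq [simp]: "n \<in> Mor G \<Longrightarrow> Cod G n = e"
  using Cod_closed Obj_eq by auto

lemma e_Mor [simp]: "e \<in> Mor G"
  using Obj_Mor Obj_eq by auto

lemma e_Obj [simp]: "e \<in> Obj G"
  using Obj_eq by auto

lemma Comp_Mor [simp]: "\<lbrakk>m \<in> Mor G; n \<in> Mor G\<rbrakk> \<Longrightarrow> Comp G m n \<in> Mor G"
  using Comp_closed by simp

lemma Comp_e [simp]: "n \<in> Mor G \<Longrightarrow> Comp G n e = n" "n \<in> Mor G \<Longrightarrow> Comp G e n = n"
  using Comp_Dom[of n] Cod_Comp_id[of n] by simp_all

sublocale Ae: ring "A e"
  by (rule ring_A) simp

lemma local_mor_eq: "local_mor G e = Mor G"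
  by (auto simp: local_mor_def)

lemma one_eq_unit: "\<one>\<^bsub>R\<^esub> = unit e"
  by (auto simp: skew_category_algebra_def monomial_def Obj_eq)

lemma unit_closed_R [simp]: "unit e \<in> carrier R"
  by (rule unit_closed) simp

lemma ring_R: "ring R"
proof (rule ringI)
  show "Group.monoid R"
  proof (rule monoidI)
    fix f assume f: "f \<in> carrier R"
    show "\<one>\<^bsub>R\<^esub> \<otimes>\<^bsub>R\<^esub> f = f"
      using f unfolding one_eq_unit
    proof (induction rule: carrier_induct)
      case (monomial a m)
      then show ?case using unit_mult_monomial[of e m a] by simp
    qed (simp_all add: r_distr)
    show "f \<otimes>\<^bsub>R\<^esub> \<one>\<^bsub>R\<^esub> = f"
      using f unfolding one_eq_unit
    proof (induction rule: carrier_induct)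
      case (monomial a m)
      then show ?case using monomial_mult_unit[of e m a] by simp
    qed (simp_all add: l_distr)
  qed (auto simp: mult_closed mult_assoc one_eq_unit)
qed (auto simp: abelian_group_R l_distr r_distr)

sublocale R: ring R
  by (rule ring_R)

text \<open>
  The elements of \<open>R\<close> with coefficients in an invariant ideal \<open>J\<close> of \<open>A e\<close> form an ideal of \<open>R\<close>.
  Invariance gives the closure under multiplication from the left.
\<close>

lemma locally_simple_if_simple:
  assumes simple: "simple_ring R"
  shows "locally_simple A G \<sigma> e"
  unfolding locally_simple_def
proof (rule notI, elim exE conjE)
  fix J assume J: "nontrivial_ideal J (A e)" and inv: "\<forall>n\<in>local_mor G e. \<sigma> n ` J \<subseteq> J"
  have Ji: "x \<otimes>\<^bsub>A e\<^esub> a \<in> J" "a \<otimes>\<^bsub>A e\<^esub> x \<in> J" if "a \<in> J" "x \<in> carrier (A e)" for a x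
    using that J by (auto simp: nontrivial_ideal_def two_sided_ideal_def)
  interpret J: additive_subgroup J "A e"
    using J by (simp add: nontrivial_ideal_def two_sided_ideal_def)
  define I where "I = {f \<in> carrier R. \<forall>n\<in>Mor G. f n \<in> J}"
  have product: "x \<otimes>\<^bsub>R\<^esub> y \<in> I" if x: "x \<in> carrier R" and y: "y \<in> carrier R"
    and J: "\<And>m n. \<lbrakk>m \<in> Mor G; n \<in> Mor G\<rbrakk> \<Longrightarrow> x m \<otimes>\<^bsub>A e\<^esub> \<sigma> m (y n) \<in> J" for x y
  proof -
    have "(x \<otimes>\<^bsub>R\<^esub> y) k \<in> J" if k: "k \<in> Mor G" for k
      unfolding coeff_mult[OF x y k finite_supp[OF x] order_refl supp_subset finite_supp[OF y]
          order_refl supp_subset]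
      using k J subsetD[OF supp_subset]
      by (intro finsum_in_additive_subgroup) (auto intro: Ae.abelian_group_axioms J.additive_subgroup_axioms)
    then show ?thesis using x y by (simp add: I_def)
  qed
  have "two_sided_ideal I R"
  proof (rule two_sided_idealI)
    fix x y assume xy: "x \<in> I" "y \<in> carrier R"
    show "y \<otimes>\<^bsub>R\<^esub> x \<in> I"
    proof (rule product)
      fix m n assume mn: "m \<in> Mor G" "n \<in> Mor G"
      then have "\<sigma> m (x n) \<in> J" using xy inv by (auto simp: I_def local_mor_eq)
      then show "y m \<otimes>\<^bsub>A e\<^esub> \<sigma> m (x n) \<in> J"
        using Ji(1) coeff_closed[OF xy(2) mn(1)] mn by simp
    qed (use xy in \<open>auto simp: I_def\<close>)
    show "x \<otimes>\<^bsub>R\<^esub> y \<in> I"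
    proof (rule product)
      fix m n assume mn: "m \<in> Mor G" "n \<in> Mor G"
      then have "\<sigma> m (y n) \<in> carrier (A e)"
        using coeff_closed[OF xy(2) mn(2)] \<sigma>_closed[OF mn(1)] by simp
      then show "x m \<otimes>\<^bsub>A e\<^esub> \<sigma> m (y n) \<in> J"
        using Ji(2) xy mn by (simp add: I_def)
    qed (use xy in \<open>auto simp: I_def\<close>)
  qed (auto simp: I_def coeff_add coeff_zero coeff_neg)
  moreover have "I \<noteq> {\<zero>\<^bsub>R\<^esub>}"
  proof -
    obtain j where j: "j \<in> J" "j \<noteq> \<zero>\<^bsub>A e\<^esub>"
      using J J.zero_closed by (auto simp: nontrivial_ideal_def)
    have "monomial A G j e \<in> I"
      using j J.a_subset by (auto simp: I_def coeff_monomial intro: monomial_closed)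
    moreover have "monomial A G j e \<noteq> \<zero>\<^bsub>R\<^esub>"
      using j coeff_zero[of e] coeff_monomial[of e j e] by auto
    ultimately show ?thesis by blast
  qed
  ultimately have "I = carrier R"
    using simple by (auto simp: simple_ring_def nontrivial_ideal_def)
  then have "unit e \<in> I" by simp
  then have "\<one>\<^bsub>A e\<^esub> \<in> J" by (auto simp: I_def coeff_monomial dest: bspec[OF _ e_Mor])
  then have "J = carrier (A e)" using Ji(1)[of "\<one>\<^bsub>A e\<^esub>"] J.a_subset by auto
  then show False using J by (simp add: nontrivial_ideal_def)
qed

text \<open>
  The natural module \<open>A e\<close> of the skew monoid ring: \<open>(a u\<^sub>n) \<cdot> x = a \<sigma>\<^sub>n(x)\<close>. It sees a morphism \<open>n\<close>
  only through \<open>\<sigma>\<^sub>n\<close>.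
\<close>

definition act :: "('g \<Rightarrow> 'a) \<Rightarrow> 'a \<Rightarrow> 'a" where
  "act f x = finsum (A e) (\<lambda>n. f n \<otimes>\<^bsub>A e\<^esub> \<sigma> n x) (supp f)"

lemma act_term_closed:
  assumes "f \<in> carrier R" "x \<in> carrier (A e)" "n \<in> Mor G"
  shows "f n \<in> carrier (A e)" "\<sigma> n x \<in> carrier (A e)"
  using assms coeff_closed[of f n] \<sigma>_closed[of n x] by auto

lemma act_eq:
  assumes f: "f \<in> carrier R" and x: "x \<in> carrier (A e)"
    and F: "finite F" "supp f \<subseteq> F" "F \<subseteq> Mor G"
  shows "act f x = finsum (A e) (\<lambda>n. f n \<otimes>\<^bsub>A e\<^esub> \<sigma> n x) F"
  unfolding act_def
proof (rule Ae.add.finprod_mono_neutral_cong_left)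
  show "f n \<otimes>\<^bsub>A e\<^esub> \<sigma> n x = \<zero>\<^bsub>A e\<^esub>" if "n \<in> F - supp f" for n
  proof -
    have n: "n \<in> Mor G" "f n = \<zero>\<^bsub>A e\<^esub>" using that F by (auto simp: supp_def)
    then show ?thesis using act_term_closed[OF f x n(1)] by simp
  qed
qed (use F act_term_closed[OF f x] in auto)

lemma act_closed: "\<lbrakk>f \<in> carrier R; x \<in> carrier (A e)\<rbrakk> \<Longrightarrow> act f x \<in> carrier (A e)"
  unfolding act_def using act_term_closed[of f x] supp_subset[of f]
  by (intro Ae.finsum_closed) auto

lemma act_add:
  assumes f: "f \<in> carrier R" and g: "g \<in> carrier R" and x: "x \<in> carrier (A e)"
  shows "act (f \<oplus>\<^bsub>R\<^esub> g) x = act f x \<oplus>\<^bsub>A e\<^esub> act g x"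
proof -
  let ?F = "supp f \<union> supp g"
  have F: "finite ?F" "supp f \<subseteq> ?F" "supp g \<subseteq> ?F" "?F \<subseteq> Mor G"
    using finite_supp f g supp_subset by auto
  have s: "supp (f \<oplus>\<^bsub>R\<^esub> g) \<subseteq> ?F"
    by (auto simp: supp_def coeff_add)
  have "act (f \<oplus>\<^bsub>R\<^esub> g) x = finsum (A e) (\<lambda>n. (f \<oplus>\<^bsub>R\<^esub> g) n \<otimes>\<^bsub>A e\<^esub> \<sigma> n x) ?F"
    using f g x F s by (intro act_eq) auto
  also have "\<dots> = finsum (A e) (\<lambda>n. f n \<otimes>\<^bsub>A e\<^esub> \<sigma> n x \<oplus>\<^bsub>A e\<^esub> g n \<otimes>\<^bsub>A e\<^esub> \<sigma> n x) ?F"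
    using F act_term_closed[OF f x] act_term_closed[OF g x]
    by (intro Ae.finsum_cong') (auto simp: coeff_add Ae.l_distr subset_iff)
  also have "\<dots> = act f x \<oplus>\<^bsub>A e\<^esub> act g x"
    unfolding act_eq[OF f x F(1,2,4)] act_eq[OF g x F(1,3,4)]
    using F act_term_closed[OF f x] act_term_closed[OF g x]
    by (intro Ae.finsum_addf) (auto simp: subset_iff)
  finally show ?thesis .
qed

lemma act_zero: "x \<in> carrier (A e) \<Longrightarrow> act \<zero>\<^bsub>R\<^esub> x = \<zero>\<^bsub>A e\<^esub>"
  using act_add[of "\<zero>\<^bsub>R\<^esub>" "\<zero>\<^bsub>R\<^esub>" x] act_closed[of "\<zero>\<^bsub>R\<^esub>" x] by simp

lemma act_neg:
  assumes "f \<in> carrier R" "x \<in> carrier (A e)"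
  shows "act (\<ominus>\<^bsub>R\<^esub> f) x = \<ominus>\<^bsub>A e\<^esub> act f x"
  using act_add[of "\<ominus>\<^bsub>R\<^esub> f" f x] assms act_zero[of x]
  by (intro Ae.minus_equality[symmetric]) (simp_all add: act_closed R.l_neg)

lemma act_monomial:
  assumes "m \<in> Mor G" "a \<in> carrier (A e)" "x \<in> carrier (A e)"
  shows "act (monomial A G a m) x = a \<otimes>\<^bsub>A e\<^esub> \<sigma> m x"
proof -
  have "act (monomial A G a m) x =
      finsum (A e) (\<lambda>n. monomial A G a m n \<otimes>\<^bsub>A e\<^esub> \<sigma> n x) {m}"
    using assms by (intro act_eq) (auto simp: supp_def coeff_monomial monomial_closed split: if_splits)
  also have "\<dots> = a \<otimes>\<^bsub>A e\<^esub> \<sigma> m x"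
    using assms \<sigma>_closed[of m x] by (simp add: coeff_monomial)
  finally show ?thesis .
qed

lemma act_mult:
  assumes f: "f \<in> carrier R" and g: "g \<in> carrier R" and x: "x \<in> carrier (A e)"
  shows "act (f \<otimes>\<^bsub>R\<^esub> g) x = act f (act g x)"
  using f
proof (induction rule: carrier_induct)
  case (monomial a m)
  have \<sigma>m: "\<sigma> m \<zero>\<^bsub>A e\<^esub> = \<zero>\<^bsub>A e\<^esub>" "\<And>y. y \<in> carrier (A e) \<Longrightarrow> \<sigma> m y \<in> carrier (A e)"
    "\<And>y z. \<lbrakk>y \<in> carrier (A e); z \<in> carrier (A e)\<rbrakk> \<Longrightarrow> \<sigma> m (y \<oplus>\<^bsub>A e\<^esub> z) = \<sigma> m y \<oplus>\<^bsub>A e\<^esub> \<sigma> m z"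
    "\<And>y z. \<lbrakk>y \<in> carrier (A e); z \<in> carrier (A e)\<rbrakk> \<Longrightarrow> \<sigma> m (y \<otimes>\<^bsub>A e\<^esub> z) = \<sigma> m y \<otimes>\<^bsub>A e\<^esub> \<sigma> m z"
    using monomial \<sigma>_zero[of m] \<sigma>_closed[of m] \<sigma>_add[of m] \<sigma>_mult[of m] by auto
  have a: "a \<in> carrier (A e)" using monomial by simp
  have mo: "monomial A G a m \<in> carrier R" using monomial monomial_closed by blast
  show ?case
    using g
  proof (induction rule: carrier_induct)
    case zero
    show ?case
      using mo x a \<sigma>m monomial by (simp add: act_zero act_monomial)
  next
    case m: (monomial b n)
    then have b: "b \<in> carrier (A e)" "\<sigma> n x \<in> carrier (A e)" using \<sigma>_closed[of n x] x by auto
    have "monomial A G a m \<otimes>\<^bsub>R\<^esub> monomial A G b n = monomial A G (a \<otimes>\<^bsub>A e\<^esub> \<sigma> m b) (Comp G m n)"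
      using monomial_mult[of m n a b] monomial m by simp
    moreover have "\<sigma> (Comp G m n) x = \<sigma> m (\<sigma> n x)"
      using \<sigma>_Comp[of m n x] x monomial m by simp
    ultimately show ?case
      using monomial m(1) a b x by (simp add: act_monomial \<sigma>m Ae.m_assoc)
  next
    case (add f g)
    then show ?case
      using mo x a monomial
      by (simp add: r_distr act_add act_closed act_monomial \<sigma>m Ae.r_distr)
  qed
qed (use g x in \<open>simp_all add: act_closed act_zero l_distr act_add\<close>)

text \<open>
  The annihilator of the module \<open>A e\<close> is an ideal without the identity, hence zero. It contains
  \<open>u\<^sub>m - u\<^sub>n\<close> if \<open>\<sigma>\<^sub>m = \<sigma>\<^sub>n\<close>.
\<close>

lemma kernel_locally_trivial_if_simple:
  assumes simple: "simple_ring R"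
  shows "kernel_locally_trivial A G \<sigma>"
proof -
  define I where "I = {f \<in> carrier R. \<forall>x\<in>carrier (A e). act f x = \<zero>\<^bsub>A e\<^esub>}"
  have "two_sided_ideal I R"
  proof (rule two_sided_idealI)
    fix f g assume fg: "f \<in> I" "g \<in> carrier R"
    have g0: "act g \<zero>\<^bsub>A e\<^esub> = \<zero>\<^bsub>A e\<^esub>"
      using act_mult[of g "\<zero>\<^bsub>R\<^esub>" "\<zero>\<^bsub>A e\<^esub>"] fg by (simp add: act_zero)
    then show "g \<otimes>\<^bsub>R\<^esub> f \<in> I" "f \<otimes>\<^bsub>R\<^esub> g \<in> I"
      using fg by (auto simp: I_def act_mult act_closed)
  qed (auto simp: I_def act_zero act_add act_neg)
  moreover have "unit e \<notin> I"
    using act_monomial[of e "\<one>\<^bsub>A e\<^esub>" "\<one>\<^bsub>A e\<^esub>"] \<sigma>_Obj[of e "\<one>\<^bsub>A e\<^esub>"] one_not_zero_A[of e]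
    by (auto simp: I_def intro!: bexI[of _ "\<one>\<^bsub>A e\<^esub>"])
  ultimately have I0: "I = {\<zero>\<^bsub>R\<^esub>}"
    using simple unit_closed_R by (auto simp: simple_ring_def nontrivial_ideal_def)
  show ?thesis
    unfolding kernel_locally_trivial_def Obj_eq
  proof (clarsimp simp: local_mor_eq)
    fix m n assume m: "m \<in> Mor G" and n: "n \<in> Mor G" and eq: "\<forall>x\<in>carrier (A e). \<sigma> m x = \<sigma> n x"
    let ?um = "monomial A G \<one>\<^bsub>A e\<^esub> m" and ?un = "monomial A G \<one>\<^bsub>A e\<^esub> n"
    have um: "?um \<in> carrier R" "?un \<in> carrier R" using m n by (auto intro: monomial_closed)
    have "act (?um \<oplus>\<^bsub>R\<^esub> \<ominus>\<^bsub>R\<^esub> ?un) x = \<zero>\<^bsub>A e\<^esub>" if x: "x \<in> carrier (A e)" for x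
      using um x eq m n \<sigma>_closed[of n x] by (simp add: act_add act_neg act_monomial Ae.r_neg)
    then have "?um \<oplus>\<^bsub>R\<^esub> \<ominus>\<^bsub>R\<^esub> ?un \<in> I" using um by (simp add: I_def)
    then have "?um \<oplus>\<^bsub>R\<^esub> \<ominus>\<^bsub>R\<^esub> ?un = \<zero>\<^bsub>R\<^esub>" using I0 by blast
    then have "?um = ?un" using um R.minus_equality[of ?um "\<ominus>\<^bsub>R\<^esub> ?un"] by simp
    then have "?um m = ?un m" by simp
    then show "m = n" using m n one_not_zero_A[of e] by (simp add: coeff_monomial split: if_splits)
  qed
qed


section \<open>Skew group rings of abelian groups\<close>

lemma monomial_closed_R: "\<lbrakk>m \<in> Mor G; a \<in> carrier (A e)\<rbrakk> \<Longrightarrow> monomial A G a m \<in> carrier R"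
  by (rule monomial_closed) simp_all

lemma inverse_pair_e: "inverse_pair e e"
  by (simp add: inverse_pair_def)

lemma coeff_scalar_mult:
  assumes "h \<in> carrier R" "a \<in> carrier (A e)" "k \<in> Mor G"
  shows "(monomial A G a e \<otimes>\<^bsub>R\<^esub> h) k = a \<otimes>\<^bsub>A e\<^esub> h k"
  using coeff_monomial_mult[OF assms(1) inverse_pair_e, of a k] assms \<sigma>_Obj[of e "h k"]
    coeff_closed[OF assms(1), of k] by simp

lemma coeff_mult_scalar:
  assumes "h \<in> carrier R" "a \<in> carrier (A e)" "k \<in> Mor G"
  shows "(h \<otimes>\<^bsub>R\<^esub> monomial A G a e) k = h k \<otimes>\<^bsub>A e\<^esub> \<sigma> k a"
  using coeff_mult_monomial[OF assms(1) inverse_pair_e, of a k] assms by simp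

text \<open>
  In an abelian group \<open>m k m\<^sup>-\<^sup>1 = k\<close>, so conjugation by \<open>u\<^sub>m\<close> moves no coefficient to another place.
\<close>

lemma coeff_conjugate:
  assumes abelian: "\<And>m n. \<lbrakk>m \<in> Mor G; n \<in> Mor G\<rbrakk> \<Longrightarrow> Comp G m n = Comp G n m"
    and h: "h \<in> carrier R" and m: "inverse_pair m m'" and k: "k \<in> Mor G"
  shows "(monomial A G \<one>\<^bsub>A e\<^esub> m \<otimes>\<^bsub>R\<^esub> h \<otimes>\<^bsub>R\<^esub> monomial A G \<one>\<^bsub>A e\<^esub> m') k = \<sigma> m (h k)"
proof -
  have mM: "m \<in> Mor G" "m' \<in> Mor G" and pair: "inverse_pair m' m" and mm: "Comp G m' m = e"
    using m by (auto simp: inverse_pair_def)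
  have "Comp G m' (Comp G k m) = k"
    using abelian[of k m] Comp_assoc[of m' m k] mM k mm by simp
  moreover have "\<sigma> m (h k) \<in> carrier (A e)"
    using \<sigma>_closed[of m "h k"] coeff_closed[OF h k] mM k by simp
  ultimately show ?thesis
    using coeff_mult_monomial[OF _ pair, of "monomial A G \<one>\<^bsub>A e\<^esub> m \<otimes>\<^bsub>R\<^esub> h" "\<one>\<^bsub>A e\<^esub>" k]
      coeff_monomial_mult[OF h m, of "\<one>\<^bsub>A e\<^esub>" "Comp G k m"] mM k h \<sigma>_one[of "Comp G k m"]
    by (simp add: monomial_closed_R)
qed

text \<open>
  Right multiplication by an invertible \<open>u\<^sub>n\<close> translates the support, so an element of minimal support
  can be moved until its support contains the identity, without loss of minimality.
\<close>

lemma minimal_support_at_identity: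
  assumes inverses: "\<And>n. n \<in> Mor G \<Longrightarrow> \<exists>m. inverse_pair n m"
    and I: "two_sided_ideal I R" and nonzero: "I \<noteq> {\<zero>\<^bsub>R\<^esub>}"
  obtains g where "g \<in> I" "e \<in> supp g"
    "\<And>h. \<lbrakk>h \<in> I; h \<noteq> \<zero>\<^bsub>R\<^esub>\<rbrakk> \<Longrightarrow> card (supp g) \<le> card (supp h)"
proof -
  interpret I: additive_subgroup I R
    using I by (simp add: two_sided_ideal_def)
  note I_mult = ideal_mult[OF I] and I_carrier = ideal_carrier[OF I]
  obtain f where f: "f \<in> I" "f \<noteq> \<zero>\<^bsub>R\<^esub>"
    and f_min: "\<And>g. \<lbrakk>g \<in> I; g \<noteq> \<zero>\<^bsub>R\<^esub>\<rbrakk> \<Longrightarrow> card (supp f) \<le> card (supp g)"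
  proof -
    obtain f0 where "f0 \<in> I \<and> f0 \<noteq> \<zero>\<^bsub>R\<^esub>"
      using nonzero I.zero_closed by blast
    then show thesis
      using that ex_has_least_nat[of "\<lambda>f. f \<in> I \<and> f \<noteq> \<zero>\<^bsub>R\<^esub>" f0 "\<lambda>f. card (supp f)"] by blast
  qed
  have "supp f \<noteq> {}" using supp_eq_empty I_carrier f by blast
  then obtain n where n: "n \<in> supp f" by blast
  then have nM: "n \<in> Mor G" using supp_subset by blast
  obtain n' where n': "inverse_pair n n'" using inverses[OF nM] by blast
  then have n'M: "n' \<in> Mor G" and n'_pair: "inverse_pair n' n"
    by (auto simp: inverse_pair_def)

  define g where "g = f \<otimes>\<^bsub>R\<^esub> monomial A G \<one>\<^bsub>A e\<^esub> n'"
  have g: "g \<in> I"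
    unfolding g_def by (intro I_mult f monomial_closed_R n'M) simp
  have coeff_g: "g k = f (Comp G k n)" if "k \<in> Mor G" for k
    unfolding g_def
    using coeff_mult_monomial[OF I_carrier[OF f(1)] n'_pair, of "\<one>\<^bsub>A e\<^esub>" k] that n'M nM
      \<sigma>_one[of "Comp G k n"] coeff_closed[OF I_carrier[OF f(1)], of "Comp G k n"] by simp
  have ge: "e \<in> supp g"
    using n nM coeff_g[of e] by (simp add: supp_def)
  have g_min: "card (supp g) \<le> card (supp h)" if "h \<in> I" "h \<noteq> \<zero>\<^bsub>R\<^esub>" for h
  proof -
    have "inj_on (\<lambda>k. Comp G k n) (supp g)"
    proof (rule inj_on_inverseI)
      fix k assume "k \<in> supp g"
      then show "Comp G (Comp G k n) n' = k"
        using Comp_assoc[of k n n'] n' n'M nM supp_subset by (auto simp: inverse_pair_def)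
    qed
    moreover have "(\<lambda>k. Comp G k n) ` supp g \<subseteq> supp f"
      using nM by (auto simp: supp_def coeff_g)
    ultimately have "card (supp g) \<le> card (supp f)"
      using finite_supp[OF I_carrier[OF f(1)]] by (simp add: card_inj_on_le)
    then show ?thesis using f_min[OF that] by simp
  qed
  show thesis using that g ge g_min by blast
qed

text \<open>
  Left and right multiplication by elements of \<open>A e\<close> and conjugation by morphisms do not enlarge the
  support. Hence the coefficients at \<open>e\<close> of the elements of \<open>I\<close> that are supported in \<open>supp g\<close> form an
  invariant ideal \<open>J\<close> of \<open>A e\<close>, which is nonzero as it contains \<open>g e\<close>.
\<close>

lemma normalize_at_identity:
  assumes inverses: "\<And>n. n \<in> Mor G \<Longrightarrow> \<exists>m. inverse_pair n m"
    and abelian: "\<And>m n. \<lbrakk>m \<in> Mor G; n \<in> Mor G\<rbrakk> \<Longrightarrow> Comp G m n = Comp G n m"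
    and locally_simple: "locally_simple A G \<sigma> e"
    and I: "two_sided_ideal I R" and g: "g \<in> I" and ge: "e \<in> supp g"
  shows "\<exists>x\<in>I. x e = \<one>\<^bsub>A e\<^esub> \<and> (\<forall>k\<in>Mor G. k \<notin> supp g \<longrightarrow> x k = \<zero>\<^bsub>A e\<^esub>)"
proof -
  interpret I: additive_subgroup I R
    using I by (simp add: two_sided_ideal_def)
  note I_mult = ideal_mult[OF I] and I_carrier = ideal_carrier[OF I]
  define J where "J = {h e | h. h \<in> I \<and> (\<forall>k\<in>Mor G. k \<notin> supp g \<longrightarrow> h k = \<zero>\<^bsub>A e\<^esub>)}"
  have J_I: "h e \<in> J" if "h \<in> I" "\<And>k. \<lbrakk>k \<in> Mor G; k \<notin> supp g\<rbrakk> \<Longrightarrow> h k = \<zero>\<^bsub>A e\<^esub>" for h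
    using that unfolding J_def by blast
  have J_E: "\<exists>h. h \<in> I \<and> a = h e \<and> (\<forall>k\<in>Mor G. k \<notin> supp g \<longrightarrow> h k = \<zero>\<^bsub>A e\<^esub>)" if "a \<in> J" for a
    using that unfolding J_def by blast
  have "two_sided_ideal J (A e)"
    unfolding two_sided_ideal_def
  proof (intro conjI ballI)
    have "subgroup J (add_monoid (A e))"
    proof (rule Ae.add.subgroupI)
      show "J \<subseteq> carrier (A e)"
        using coeff_closed[OF I_carrier, of _ e] by (auto simp: J_def)
      show "J \<noteq> {}" using J_I[OF g] by (auto simp: supp_def)
    next
      fix a assume "a \<in> J"
      then obtain h where h: "h \<in> I" "a = h e" "\<forall>k\<in>Mor G. k \<notin> supp g \<longrightarrow> h k = \<zero>\<^bsub>A e\<^esub>"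
        using J_E by blast
      have "(\<ominus>\<^bsub>R\<^esub> h) e \<in> J"
        by (rule J_I) (use h in \<open>auto simp: coeff_neg I_carrier\<close>)
      then show "\<ominus>\<^bsub>A e\<^esub> a \<in> J" using h by (simp add: coeff_neg I_carrier)
    next
      fix a b assume "a \<in> J" "b \<in> J"
      then obtain h k where h: "h \<in> I" "a = h e" "\<forall>k\<in>Mor G. k \<notin> supp g \<longrightarrow> h k = \<zero>\<^bsub>A e\<^esub>"
        and k: "k \<in> I" "b = k e" "\<forall>l\<in>Mor G. l \<notin> supp g \<longrightarrow> k l = \<zero>\<^bsub>A e\<^esub>"
        using J_E by metis
      have "(h \<oplus>\<^bsub>R\<^esub> k) e \<in> J"
        by (rule J_I) (use h k in \<open>auto simp: coeff_add\<close>)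
      then show "a \<oplus>\<^bsub>A e\<^esub> b \<in> J" using h k by (simp add: coeff_add)
    qed
    then show "additive_subgroup J (A e)" by (simp add: additive_subgroup_def)
  next
    fix a x assume "a \<in> J" and x: "x \<in> carrier (A e)"
    then obtain h where h: "h \<in> I" "a = h e" "\<forall>k\<in>Mor G. k \<notin> supp g \<longrightarrow> h k = \<zero>\<^bsub>A e\<^esub>"
      using J_E by blast
    have "(monomial A G x e \<otimes>\<^bsub>R\<^esub> h) e \<in> J"
      by (rule J_I) (use h x in \<open>auto simp: coeff_scalar_mult I_carrier monomial_closed_R intro: I_mult\<close>)
    then show "x \<otimes>\<^bsub>A e\<^esub> a \<in> J" using h x by (simp add: coeff_scalar_mult I_carrier)
    have "(h \<otimes>\<^bsub>R\<^esub> monomial A G x e) e \<in> J"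
      by (rule J_I) (use h x \<sigma>_closed[of _ x] in \<open>auto simp: coeff_mult_scalar I_carrier monomial_closed_R intro: I_mult\<close>)
    then show "a \<otimes>\<^bsub>A e\<^esub> x \<in> J" using h x by (simp add: coeff_mult_scalar I_carrier \<sigma>_Obj)
  qed
  moreover have "\<sigma> m ` J \<subseteq> J" if m: "m \<in> local_mor G e" for m
  proof
    fix b assume "b \<in> \<sigma> m ` J"
    then obtain h where h: "h \<in> I" "b = \<sigma> m (h e)" "\<forall>k\<in>Mor G. k \<notin> supp g \<longrightarrow> h k = \<zero>\<^bsub>A e\<^esub>"
      using J_E by blast
    have mM: "m \<in> Mor G" using m local_mor_eq by simp
    obtain m' where m': "inverse_pair m m'" using inverses[OF mM] by blast
    then have m'M: "m' \<in> Mor G" by (simp add: inverse_pair_def)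
    (* Conjugation by u_m realizes the action of m on the coefficient at e. *)
    define c where "c = monomial A G \<one>\<^bsub>A e\<^esub> m \<otimes>\<^bsub>R\<^esub> h \<otimes>\<^bsub>R\<^esub> monomial A G \<one>\<^bsub>A e\<^esub> m'"
    have c: "c \<in> I"
      unfolding c_def using h mM m'M by (intro I_mult monomial_closed_R) simp_all
    have coeff_c: "c k = \<sigma> m (h k)" if "k \<in> Mor G" for k
      unfolding c_def by (rule coeff_conjugate[OF abelian I_carrier[OF h(1)] m' that])
    have "c e \<in> J"
      by (rule J_I[OF c]) (use h mM \<sigma>_zero[of m] in \<open>simp add: coeff_c\<close>)
    then show "b \<in> J" using h by (simp add: coeff_c)
  qed
  moreover have "g e \<in> J" "g e \<noteq> \<zero>\<^bsub>A e\<^esub>"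
    using J_I[OF g] ge by (auto simp: supp_def)
  then have "J \<noteq> {\<zero>\<^bsub>A e\<^esub>}" by blast
  ultimately have "J = carrier (A e)"
    using locally_simple unfolding locally_simple_def nontrivial_ideal_def by blast
  then show ?thesis
    using J_E[of "\<one>\<^bsub>A e\<^esub>"] by auto
qed

text \<open>
  Let \<open>x\<close> be normalized, with coefficient \<open>1\<close> at \<open>e\<close> and minimal support. Both \<open>x a - a x\<close> and
  \<open>u\<^sub>m x u\<^sub>m\<^sup>-\<^sup>1 - x\<close> have coefficient zero at \<open>e\<close> and no new places in their support, so they vanish by
  minimality, and \<open>x\<close> is central.
\<close>

lemma simple_if_abelian_group:
  assumes inverses: "\<And>n. n \<in> Mor G \<Longrightarrow> \<exists>m. inverse_pair n m"
    and abelian: "\<And>m n. \<lbrakk>m \<in> Mor G; n \<in> Mor G\<rbrakk> \<Longrightarrow> Comp G m n = Comp G n m"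
    and locally_simple: "locally_simple A G \<sigma> e"
    and center_field: "field (center_ring R)"
  shows "simple_ring R"
  unfolding simple_ring_def
proof (rule notI, elim exE)
  fix I assume nontrivial: "nontrivial_ideal I R"
  then have I: "two_sided_ideal I R" and "I \<noteq> {\<zero>\<^bsub>R\<^esub>}" and "I \<noteq> carrier R"
    by (auto simp: nontrivial_ideal_def)
  interpret I: additive_subgroup I R
    using I by (simp add: two_sided_ideal_def)
  note I_mult = ideal_mult[OF I] and I_carrier = ideal_carrier[OF I]
  obtain g where g: "g \<in> I" and ge: "e \<in> supp g"
    and g_min: "\<And>h. \<lbrakk>h \<in> I; h \<noteq> \<zero>\<^bsub>R\<^esub>\<rbrakk> \<Longrightarrow> card (supp g) \<le> card (supp h)"
    using minimal_support_at_identity[OF inverses I \<open>I \<noteq> {\<zero>\<^bsub>R\<^esub>}\<close>] by blast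
  obtain x where x: "x \<in> I" "x e = \<one>\<^bsub>A e\<^esub>" "\<forall>k\<in>Mor G. k \<notin> supp g \<longrightarrow> x k = \<zero>\<^bsub>A e\<^esub>"
    using normalize_at_identity[OF inverses abelian locally_simple I g ge] by blast
  have xR: "x \<in> carrier R" using x I_carrier by blast
  have vanish: "y = \<zero>\<^bsub>R\<^esub>" if "y \<in> I" "supp y \<subseteq> supp g" "y e = \<zero>\<^bsub>A e\<^esub>" for y
  proof (rule ccontr)
    assume "y \<noteq> \<zero>\<^bsub>R\<^esub>"
    then have "card (supp g) \<le> card (supp y)" using g_min that by blast
    then have "supp y = supp g"
      using card_seteq[OF finite_supp[OF I_carrier[OF g]] that(2)] by blast
    then have "e \<in> supp y" using ge by simp
    then show False using that(3) by (simp add: supp_def)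
  qed

  (* Minimality as a comparison principle: the difference y - z would have smaller support. *)
  have eqI: "y = z" if "y \<in> I" "z \<in> I" "y e = z e"
    "\<And>k. \<lbrakk>k \<in> Mor G; k \<notin> supp g\<rbrakk> \<Longrightarrow> y k = \<zero>\<^bsub>A e\<^esub> \<and> z k = \<zero>\<^bsub>A e\<^esub>" for y z
  proof -
    have yz: "y \<in> carrier R" "z \<in> carrier R" using that I_carrier by auto
    have "y \<oplus>\<^bsub>R\<^esub> \<ominus>\<^bsub>R\<^esub> z = \<zero>\<^bsub>R\<^esub>"
    proof (rule vanish)
      show "y \<oplus>\<^bsub>R\<^esub> \<ominus>\<^bsub>R\<^esub> z \<in> I" using that by simp
      show "supp (y \<oplus>\<^bsub>R\<^esub> \<ominus>\<^bsub>R\<^esub> z) \<subseteq> supp g"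
      proof
        fix k assume k: "k \<in> supp (y \<oplus>\<^bsub>R\<^esub> \<ominus>\<^bsub>R\<^esub> z)"
        then have kM: "k \<in> Mor G" using supp_subset by blast
        show "k \<in> supp g"
          using that(4)[OF kM] k yz kM by (fastforce simp: supp_def coeff_add coeff_neg)
      qed
      show "(y \<oplus>\<^bsub>R\<^esub> \<ominus>\<^bsub>R\<^esub> z) e = \<zero>\<^bsub>A e\<^esub>"
        using that(3) yz coeff_closed[OF yz(2), of e] by (simp add: coeff_add coeff_neg Ae.r_neg)
    qed
    then show ?thesis using yz R.minus_equality[of y "\<ominus>\<^bsub>R\<^esub> z"] by simp
  qed
  have comm_A: "x \<otimes>\<^bsub>R\<^esub> monomial A G a e = monomial A G a e \<otimes>\<^bsub>R\<^esub> x" if a: "a \<in> carrier (A e)" for a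
  proof (rule eqI)
    have ua: "monomial A G a e \<in> carrier R" using monomial_closed_R a by simp
    show "x \<otimes>\<^bsub>R\<^esub> monomial A G a e \<in> I" "monomial A G a e \<otimes>\<^bsub>R\<^esub> x \<in> I"
      using I_mult[OF x(1) ua] by auto
    show "(x \<otimes>\<^bsub>R\<^esub> monomial A G a e) e = (monomial A G a e \<otimes>\<^bsub>R\<^esub> x) e"
      using x(2) a xR by (simp add: coeff_scalar_mult coeff_mult_scalar \<sigma>_Obj)
    show "(x \<otimes>\<^bsub>R\<^esub> monomial A G a e) k = \<zero>\<^bsub>A e\<^esub> \<and> (monomial A G a e \<otimes>\<^bsub>R\<^esub> x) k = \<zero>\<^bsub>A e\<^esub>"
      if "k \<in> Mor G" "k \<notin> supp g" for k
      using x(3) that a xR \<sigma>_closed[of k a] by (simp add: coeff_scalar_mult coeff_mult_scalar)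
  qed
  have comm_G: "x \<otimes>\<^bsub>R\<^esub> monomial A G \<one>\<^bsub>A e\<^esub> m = monomial A G \<one>\<^bsub>A e\<^esub> m \<otimes>\<^bsub>R\<^esub> x" if m: "m \<in> Mor G" for m
  proof -
    obtain m' where m': "inverse_pair m m'" using inverses[OF m] by blast
    then have m'M: "m' \<in> Mor G" and "Comp G m' m = Dom G m"
      unfolding inverse_pair_def by blast+
    from this(2) Dom_eq[OF m] have mm: "Comp G m' m = e" by (rule trans)
    let ?u = "monomial A G \<one>\<^bsub>A e\<^esub> m" and ?v = "monomial A G \<one>\<^bsub>A e\<^esub> m'"
    have c: "?u \<in> carrier R" "?v \<in> carrier R" by (simp_all add: monomial_closed_R m m'M)
    have vu: "?v \<otimes>\<^bsub>R\<^esub> ?u = \<one>\<^bsub>R\<^esub>"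
      using monomial_mult[of m' m "\<one>\<^bsub>A e\<^esub>" "\<one>\<^bsub>A e\<^esub>"] m m'M mm \<sigma>_one[of m'] by (simp add: one_eq_unit)
    have conj: "(?u \<otimes>\<^bsub>R\<^esub> x \<otimes>\<^bsub>R\<^esub> ?v) k = \<sigma> m (x k)" if "k \<in> Mor G" for k
      by (rule coeff_conjugate[OF abelian xR m' that])
    have "?u \<otimes>\<^bsub>R\<^esub> x \<otimes>\<^bsub>R\<^esub> ?v = x"
    proof (rule eqI)
      show "?u \<otimes>\<^bsub>R\<^esub> x \<otimes>\<^bsub>R\<^esub> ?v \<in> I" using I_mult x(1) c by blast
      show "(?u \<otimes>\<^bsub>R\<^esub> x \<otimes>\<^bsub>R\<^esub> ?v) e = x e"
        using conj[of e] x(2) m \<sigma>_one[of m] by simp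
      show "(?u \<otimes>\<^bsub>R\<^esub> x \<otimes>\<^bsub>R\<^esub> ?v) k = \<zero>\<^bsub>A e\<^esub> \<and> x k = \<zero>\<^bsub>A e\<^esub>" if "k \<in> Mor G" "k \<notin> supp g" for k
        using conj[of k] x(3) that m \<sigma>_zero[of m] by simp
    qed (rule x(1))
    then have "x \<otimes>\<^bsub>R\<^esub> ?u = ?u \<otimes>\<^bsub>R\<^esub> x \<otimes>\<^bsub>R\<^esub> ?v \<otimes>\<^bsub>R\<^esub> ?u" by simp
    also have "\<dots> = ?u \<otimes>\<^bsub>R\<^esub> x" using c xR vu by (simp add: R.m_assoc)
    finally show ?thesis .
  qed
  have central: "x \<otimes>\<^bsub>R\<^esub> y = y \<otimes>\<^bsub>R\<^esub> x" if "y \<in> carrier R" for y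
    using that
  proof (induction rule: carrier_induct)
    case (monomial a m)
    then have a: "a \<in> carrier (A e)" by simp
    let ?a = "monomial A G a e" and ?u = "monomial A G \<one>\<^bsub>A e\<^esub> m"
    have c: "?a \<in> carrier R" "?u \<in> carrier R" using monomial_closed_R monomial a by auto
    (* The scalars a u_e and the morphisms u_m together generate all monomials. *)
    have au: "monomial A G a m = ?a \<otimes>\<^bsub>R\<^esub> ?u"
      using monomial_mult[of e m a "\<one>\<^bsub>A e\<^esub>"] monomial a \<sigma>_Obj[of e "\<one>\<^bsub>A e\<^esub>"] by simp
    have "x \<otimes>\<^bsub>R\<^esub> (?a \<otimes>\<^bsub>R\<^esub> ?u) = ?a \<otimes>\<^bsub>R\<^esub> x \<otimes>\<^bsub>R\<^esub> ?u"
      using c xR comm_A[OF a] by (simp add: R.m_assoc[symmetric])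
    also have "\<dots> = ?a \<otimes>\<^bsub>R\<^esub> ?u \<otimes>\<^bsub>R\<^esub> x"
      using c xR comm_G[OF monomial(1)] by (simp add: R.m_assoc)
    finally show ?case unfolding au .
  qed (use xR in \<open>simp_all add: l_distr r_distr\<close>)
  interpret Z: field "center_ring R" by (rule center_field)
  have "x \<noteq> \<zero>\<^bsub>R\<^esub>"
    using x(2) one_not_zero_A[of e] coeff_zero[of e] by auto
  then have "x \<in> Units (center_ring R)"
    unfolding Z.field_Units using xR central by (simp add: center_ring_def)
  then obtain y where "y \<in> carrier R" "x \<otimes>\<^bsub>R\<^esub> y = \<one>\<^bsub>R\<^esub>"
    by (auto simp: Units_def center_ring_def)
  then have "unit e \<in> I"
    using I_mult(2)[OF x(1), of y] by (simp add: one_eq_unit)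
  then have "I = carrier R"
    by (intro ideal_eq_carrier[OF I]) (simp add: Obj_eq)
  then show False using \<open>I \<noteq> carrier R\<close> by blast
qed

end


section \<open>Corners\<close>

context skew_category_system
begin

abbreviation corner where "corner e \<equiv> skew_category_algebra A (local_category G e) \<sigma>"

lemma local_category_sel [simp]:
  "Obj (local_category G e) = {e}" "Mor (local_category G e) = local_mor G e"
  "Dom (local_category G e) = Dom G" "Cod (local_category G e) = Cod G"
  "Comp (local_category G e) = Comp G"
  by (simp_all add: local_category_def)

lemma local_monoid_system:
  assumes e: "e \<in> Obj G"
  shows "skew_monoid_system A (local_category G e) \<sigma> e"
proof (intro skew_monoid_system.intro skew_category_system.intro small_category.intro
    skew_category_system_axioms.intro skew_monoid_system_axioms.intro)
  show "Obj (local_category G e) \<subseteq> Mor (local_category G e)"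
    using e Obj_Mor Dom_Obj Cod_Obj by (auto simp: local_mor_def)
  show "\<sigma> n \<in> ring_hom (A (Dom (local_category G e) n)) (A (Cod (local_category G e) n))"
    if "n \<in> Mor (local_category G e)" for n
    using that \<sigma>_hom[of n] by (simp add: local_mor_def)
  show "Comp (local_category G e) n (Dom (local_category G e) n) = n"
    "Comp (local_category G e) (Cod (local_category G e) n) n = n"
    if "n \<in> Mor (local_category G e)" for n
    using that Comp_Dom[of n] Cod_Comp_id[of n] by (simp_all add: local_mor_def)
qed (use e in \<open>auto simp: local_mor_def Dom_Obj Cod_Obj Comp_closed Dom_Comp Cod_Comp Comp_assoc
      ring_A one_not_zero_A \<sigma>_Obj \<sigma>_Comp\<close>)

text \<open>
  Elements of the corner are functions that are undefined outside \<open>G\<^sub>e\<close>, so the corner is not literally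
  a subset of \<open>R\<close>. It is embedded by \<open>extend e\<close>; \<open>truncate e\<close> is a left inverse, additive but in
  general not multiplicative.
\<close>

definition extend :: "'g \<Rightarrow> ('g \<Rightarrow> 'a) \<Rightarrow> 'g \<Rightarrow> 'a" where
  "extend e f = (\<lambda>n\<in>Mor G. if n \<in> local_mor G e then f n else \<zero>\<^bsub>B n\<^esub>)"

definition truncate :: "'g \<Rightarrow> ('g \<Rightarrow> 'a) \<Rightarrow> 'g \<Rightarrow> 'a" where
  "truncate e f = restrict f (local_mor G e)"

lemma local_mor_Mor: "n \<in> local_mor G e \<Longrightarrow> n \<in> Mor G"
  by (simp add: local_mor_def)

lemma coeff_extend:
  "n \<in> Mor G \<Longrightarrow> extend e f n = (if n \<in> local_mor G e then f n else \<zero>\<^bsub>B n\<^esub>)"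
  by (simp add: extend_def)

lemma coeff_truncate: "n \<in> local_mor G e \<Longrightarrow> truncate e f n = f n"
  by (simp add: truncate_def)

context
  fixes e assumes e: "e \<in> Obj G"
begin

interpretation S: skew_monoid_system A "local_category G e" \<sigma> e
  by (rule local_monoid_system[OF e])

lemma extend_closed:
  assumes z: "z \<in> carrier (corner e)"
  shows "extend e z \<in> carrier R"
proof -
  have "supp (extend e z) \<subseteq> S.supp z"
    by (auto simp: supp_def S.supp_def coeff_extend split: if_splits)
  then have "finite (supp (extend e z))"
    using finite_subset S.finite_supp[OF z] by blast
  moreover have "extend e z n \<in> carrier (B n)" if "n \<in> Mor G" for n
    using that S.coeff_closed[OF z, of n] ring_B[of n]
    by (simp add: coeff_extend ring.ring_simprules)
  ultimately show ?thesis by (simp add: carrier_iff extend_def)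
qed

lemma truncate_closed:
  assumes f: "f \<in> carrier R"
  shows "truncate e f \<in> carrier (corner e)"
proof -
  have "S.supp (truncate e f) \<subseteq> supp f"
    by (auto simp: supp_def S.supp_def coeff_truncate local_mor_Mor)
  then have "finite (S.supp (truncate e f))"
    using finite_subset finite_supp[OF f] by blast
  moreover have "truncate e f n \<in> carrier (B n)" if "n \<in> local_mor G e" for n
    using that coeff_closed[OF f] local_mor_Mor by (simp add: coeff_truncate)
  ultimately show ?thesis by (simp add: S.carrier_iff truncate_def)
qed

lemma truncate_extend:
  assumes "z \<in> carrier (corner e)"
  shows "truncate e (extend e z) = z"
  by (rule S.coeff_eqI)
    (use assms in \<open>auto simp: coeff_truncate coeff_extend local_mor_Mor extend_closed truncate_closed\<close>)

lemma truncate_add: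
  assumes "f \<in> carrier R" "g \<in> carrier R"
  shows "truncate e (f \<oplus>\<^bsub>R\<^esub> g) = truncate e f \<oplus>\<^bsub>corner e\<^esub> truncate e g"
  by (rule S.coeff_eqI)
    (use assms in \<open>auto simp: coeff_truncate coeff_add S.coeff_add local_mor_Mor
      intro!: truncate_closed S.add_closed add_closed\<close>)

lemma truncate_neg:
  assumes "f \<in> carrier R"
  shows "truncate e (\<ominus>\<^bsub>R\<^esub> f) = \<ominus>\<^bsub>corner e\<^esub> truncate e f"
  by (rule S.coeff_eqI)
    (use assms in \<open>auto simp: coeff_truncate coeff_neg S.coeff_neg local_mor_Mor truncate_closed\<close>)

lemma truncate_zero: "truncate e \<zero>\<^bsub>R\<^esub> = \<zero>\<^bsub>corner e\<^esub>"
  by (rule S.coeff_eqI)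
    (auto simp: coeff_truncate coeff_zero S.coeff_zero local_mor_Mor intro!: truncate_closed)

lemma extend_add:
  assumes "y \<in> carrier (corner e)" "z \<in> carrier (corner e)"
  shows "extend e (y \<oplus>\<^bsub>corner e\<^esub> z) = extend e y \<oplus>\<^bsub>R\<^esub> extend e z"
proof (rule coeff_eqI)
  fix n assume n: "n \<in> Mor G"
  interpret n: ring "B n" using ring_B n .
  show "extend e (y \<oplus>\<^bsub>corner e\<^esub> z) n = (extend e y \<oplus>\<^bsub>R\<^esub> extend e z) n"
    using n by (simp add: coeff_extend coeff_add S.coeff_add)
qed (use assms in \<open>auto intro!: extend_closed S.add_closed add_closed\<close>)

lemma extend_neg:
  assumes "z \<in> carrier (corner e)"
  shows "extend e (\<ominus>\<^bsub>corner e\<^esub> z) = \<ominus>\<^bsub>R\<^esub> extend e z"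
proof (rule coeff_eqI)
  fix n assume n: "n \<in> Mor G"
  interpret n: ring "B n" using ring_B n .
  show "extend e (\<ominus>\<^bsub>corner e\<^esub> z) n = (\<ominus>\<^bsub>R\<^esub> extend e z) n"
    using n assms by (simp add: coeff_extend coeff_neg extend_closed S.coeff_neg)
qed (use assms in \<open>auto intro!: extend_closed\<close>)

lemma extend_zero: "extend e \<zero>\<^bsub>corner e\<^esub> = \<zero>\<^bsub>R\<^esub>"
  by (rule coeff_eqI) (auto simp: coeff_extend coeff_zero S.coeff_zero intro!: extend_closed)

lemma extend_monomial:
  assumes "n \<in> local_mor G e"
  shows "extend e (monomial A (local_category G e) a n) = monomial A G a n"
  using assms by (auto simp: extend_def monomial_def local_mor_def)

lemma extend_one: "extend e \<one>\<^bsub>corner e\<^esub> = unit e"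
  unfolding S.one_eq_unit using extend_monomial[of e] S.e_Mor by simp

lemma extend_mult:
  assumes y: "y \<in> carrier (corner e)" and z: "z \<in> carrier (corner e)"
  shows "extend e (y \<otimes>\<^bsub>corner e\<^esub> z) = extend e y \<otimes>\<^bsub>R\<^esub> extend e z"
  using y
proof (induction rule: S.carrier_induct)
  case m: (monomial a m)
  then have mM: "m \<in> local_mor G e" by simp
  note mc = S.monomial_closed[OF m]
  show ?case
    using z
  proof (induction rule: S.carrier_induct)
    case n: (monomial b n)
    then have nM: "n \<in> local_mor G e" by simp
    have mnM: "Comp G m n \<in> local_mor G e" "Dom G m = Cod G n"
      using mM nM S.Comp_Mor[of m n] by (auto simp: local_mor_def)
    show ?case
      using S.monomial_mult[OF m(1) n(1) m(2) n(2)] monomial_mult[of m n a b] m n mM nM mnM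
      by (simp add: extend_monomial local_mor_Mor)
  qed (use mc in \<open>simp_all add: extend_add extend_zero S.r_distr r_distr extend_closed S.mult_closed\<close>)
qed (use z in \<open>simp_all add: extend_add extend_zero S.l_distr l_distr extend_closed S.mult_closed\<close>)

text \<open>
  This identifies \<open>A\<^sub>e \<rtimes> G\<^sub>e\<close> with \<open>u\<^sub>e R u\<^sub>e\<close>.
\<close>

lemma unit_mult_unit:
  assumes f: "f \<in> carrier R"
  shows "unit e \<otimes>\<^bsub>R\<^esub> f \<otimes>\<^bsub>R\<^esub> unit e = extend e (truncate e f)"
  using f
proof (induction rule: carrier_induct)
  case (monomial a n)
  have mc: "monomial A G a n \<in> carrier R" using monomial_closed monomial by blast
  show ?case
  proof (cases "n \<in> local_mor G e")
    case True
    then have "extend e (truncate e (monomial A G a n)) = monomial A G a n"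
      by (auto simp: extend_def truncate_def monomial_def local_mor_def)
    then show ?thesis
      using True unit_mult_monomial[OF e monomial] monomial_mult_unit[OF e monomial]
      by (simp add: local_mor_def)
  next
    case False
    have "extend e (truncate e (monomial A G a n)) = \<zero>\<^bsub>R\<^esub>"
      by (rule coeff_eqI)
        (use False mc in \<open>auto simp: extend_closed truncate_closed coeff_extend coeff_truncate
          coeff_monomial coeff_zero\<close>)
    then show ?thesis
      using False unit_mult_monomial[OF e monomial] monomial_mult_unit[OF e monomial] unit_closed[OF e]
        monomial(1)
      by (auto simp: local_mor_def)
  qed
qed (use unit_closed[OF e] in \<open>simp_all add: truncate_add truncate_zero truncate_closed extend_add
      extend_zero l_distr r_distr mult_closed\<close>)

text \<open>
  An ideal \<open>L\<close> of the corner is pushed up to the largest ideal \<open>I\<close> of \<open>R\<close> with \<open>u\<^sub>e I u\<^sub>e \<subseteq> L\<close>. This avoids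
  a description of the ideal that is generated by \<open>L\<close>. It contains \<open>L\<close>, since
  \<open>u\<^sub>e r z s u\<^sub>e = (u\<^sub>e r u\<^sub>e) z (u\<^sub>e s u\<^sub>e)\<close> for \<open>z\<close> in the corner.
\<close>

lemma simple_corner_if_simple:
  assumes simple: "simple_ring R"
  shows "simple_ring (corner e)"
  unfolding simple_ring_def
proof (rule notI, elim exE)
  fix L assume nontrivial: "nontrivial_ideal L (corner e)"
  then have L: "two_sided_ideal L (corner e)"
    by (simp add: nontrivial_ideal_def)
  interpret L: additive_subgroup L "corner e"
    using L by (simp add: two_sided_ideal_def)
  note L_mult = S.ideal_mult[OF L]
  have u: "unit e \<in> carrier R" by (rule unit_closed[OF e])
  define I where "I = {f \<in> carrier R. \<forall>r\<in>carrier R. \<forall>s\<in>carrier R. truncate e (r \<otimes>\<^bsub>R\<^esub> f \<otimes>\<^bsub>R\<^esub> s) \<in> L}"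
  have "two_sided_ideal I R"
  proof (rule two_sided_idealI)
    fix f x assume f: "f \<in> I" and x: "x \<in> carrier R"
    have fR: "f \<in> carrier R" using f by (simp add: I_def)
    show "x \<otimes>\<^bsub>R\<^esub> f \<in> I"
      unfolding I_def
    proof (intro CollectI conjI ballI)
      fix r s assume r: "r \<in> carrier R" and s: "s \<in> carrier R"
      have "truncate e (r \<otimes>\<^bsub>R\<^esub> x \<otimes>\<^bsub>R\<^esub> f \<otimes>\<^bsub>R\<^esub> s) \<in> L"
        using f r s x mult_closed by (simp add: I_def)
      then show "truncate e (r \<otimes>\<^bsub>R\<^esub> (x \<otimes>\<^bsub>R\<^esub> f) \<otimes>\<^bsub>R\<^esub> s) \<in> L"
        using r x fR by (simp add: mult_assoc)
    qed (use fR x mult_closed in auto)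
    show "f \<otimes>\<^bsub>R\<^esub> x \<in> I"
      unfolding I_def
    proof (intro CollectI conjI ballI)
      fix r s assume r: "r \<in> carrier R" and s: "s \<in> carrier R"
      have "truncate e (r \<otimes>\<^bsub>R\<^esub> f \<otimes>\<^bsub>R\<^esub> (x \<otimes>\<^bsub>R\<^esub> s)) \<in> L"
        using f r s x mult_closed by (simp add: I_def)
      then show "truncate e (r \<otimes>\<^bsub>R\<^esub> (f \<otimes>\<^bsub>R\<^esub> x) \<otimes>\<^bsub>R\<^esub> s) \<in> L"
        using r x s fR by (simp add: mult_assoc mult_closed)
    qed (use fR x mult_closed in auto)
  next
    fix f assume f: "f \<in> I"
    have "r \<otimes>\<^bsub>R\<^esub> (\<ominus>\<^bsub>R\<^esub> f) \<otimes>\<^bsub>R\<^esub> s = \<ominus>\<^bsub>R\<^esub> (r \<otimes>\<^bsub>R\<^esub> f \<otimes>\<^bsub>R\<^esub> s)"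
      if r: "r \<in> carrier R" and s: "s \<in> carrier R" for r s
    proof -
      have fR: "f \<in> carrier R" using f by (simp add: I_def)
      have "r \<otimes>\<^bsub>R\<^esub> (\<ominus>\<^bsub>R\<^esub> f) \<otimes>\<^bsub>R\<^esub> s \<oplus>\<^bsub>R\<^esub> r \<otimes>\<^bsub>R\<^esub> f \<otimes>\<^bsub>R\<^esub> s = r \<otimes>\<^bsub>R\<^esub> (\<ominus>\<^bsub>R\<^esub> f \<oplus>\<^bsub>R\<^esub> f) \<otimes>\<^bsub>R\<^esub> s"
        using fR r s by (simp only: l_distr r_distr mult_closed R.a_inv_closed)
      also have "\<dots> = \<zero>\<^bsub>R\<^esub>" using fR r s by (simp add: R.l_neg)
      finally show ?thesis using fR r s by (intro R.minus_equality[symmetric]) (simp_all add: mult_closed)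
    qed
    then show "\<ominus>\<^bsub>R\<^esub> f \<in> I" using f by (auto simp: I_def truncate_neg mult_closed)
  qed (auto simp: I_def l_distr r_distr mult_closed truncate_add truncate_zero)
  moreover have "I \<noteq> {\<zero>\<^bsub>R\<^esub>}"
  proof -
    obtain z where z: "z \<in> L" "z \<noteq> \<zero>\<^bsub>corner e\<^esub>"
      using nontrivial L.zero_closed by (auto simp: nontrivial_ideal_def)
    then have zS: "z \<in> carrier (corner e)" using L.a_subset by blast
    let ?z = "extend e z"
    have zR: "?z \<in> carrier R" by (rule extend_closed[OF zS])
    have uzu: "unit e \<otimes>\<^bsub>R\<^esub> ?z \<otimes>\<^bsub>R\<^esub> unit e = ?z"
      using unit_mult_unit[OF zR] truncate_extend[OF zS] by simp
    have "truncate e (r \<otimes>\<^bsub>R\<^esub> ?z \<otimes>\<^bsub>R\<^esub> s) \<in> L" if r: "r \<in> carrier R" and s: "s \<in> carrier R" for r s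
    proof -
      let ?r = "truncate e r" and ?s = "truncate e s"
      have rs: "?r \<in> carrier (corner e)" "?s \<in> carrier (corner e)" using truncate_closed r s by auto
      have "extend e (truncate e (r \<otimes>\<^bsub>R\<^esub> ?z \<otimes>\<^bsub>R\<^esub> s)) = unit e \<otimes>\<^bsub>R\<^esub> (r \<otimes>\<^bsub>R\<^esub> ?z \<otimes>\<^bsub>R\<^esub> s) \<otimes>\<^bsub>R\<^esub> unit e"
        using unit_mult_unit r s zR mult_closed by simp
      also have "\<dots> = unit e \<otimes>\<^bsub>R\<^esub> (r \<otimes>\<^bsub>R\<^esub> (unit e \<otimes>\<^bsub>R\<^esub> ?z \<otimes>\<^bsub>R\<^esub> unit e) \<otimes>\<^bsub>R\<^esub> s) \<otimes>\<^bsub>R\<^esub> unit e"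
        unfolding uzu ..
      also have "\<dots> = (unit e \<otimes>\<^bsub>R\<^esub> r \<otimes>\<^bsub>R\<^esub> unit e) \<otimes>\<^bsub>R\<^esub> ?z \<otimes>\<^bsub>R\<^esub> (unit e \<otimes>\<^bsub>R\<^esub> s \<otimes>\<^bsub>R\<^esub> unit e)"
        using u r s zR by (simp add: mult_assoc mult_closed)
      also have "\<dots> = extend e (?r \<otimes>\<^bsub>corner e\<^esub> z \<otimes>\<^bsub>corner e\<^esub> ?s)"
        using rs zS r s by (simp add: unit_mult_unit extend_mult S.mult_closed)
      finally have "truncate e (r \<otimes>\<^bsub>R\<^esub> ?z \<otimes>\<^bsub>R\<^esub> s) = ?r \<otimes>\<^bsub>corner e\<^esub> z \<otimes>\<^bsub>corner e\<^esub> ?s"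
        using rs zS r s zR truncate_extend by (metis S.mult_closed mult_closed truncate_closed)
      then show ?thesis using L_mult z rs by simp
    qed
    then have "?z \<in> I" using zR by (simp add: I_def)
    moreover have "?z \<noteq> \<zero>\<^bsub>R\<^esub>"
      using z(2) truncate_extend[OF zS] truncate_zero by metis
    ultimately show ?thesis by blast
  qed
  ultimately have "I = carrier R"
    using simple unfolding simple_ring_def nontrivial_ideal_def by blast
  then have "truncate e (unit e \<otimes>\<^bsub>R\<^esub> unit e \<otimes>\<^bsub>R\<^esub> unit e) \<in> L"
    using u by (auto simp: I_def)
  moreover have "truncate e (unit e \<otimes>\<^bsub>R\<^esub> unit e \<otimes>\<^bsub>R\<^esub> unit e) = \<one>\<^bsub>corner e\<^esub>"
    using unit_mult_unit[OF u] truncate_extend[OF truncate_closed[OF u]]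
      truncate_extend[OF S.R.one_closed] extend_one by simp
  ultimately have "\<one>\<^bsub>corner e\<^esub> \<in> L" by simp
  then have "L = carrier (corner e)"
    using L_mult(1) S.R.r_one L.a_subset by (metis subsetI subset_antisym)
  then show False using nontrivial by (simp add: nontrivial_ideal_def)
qed

end

text \<open>
  Multiplication by an invertible morphism moves a nonzero coefficient of an element of the ideal to
  an identity \<open>h\<close>, so the ideal meets the corner at \<open>h\<close> and contains \<open>u\<^sub>h\<close>. If \<open>e = p q\<close> factors through
  \<open>h\<close>, then \<open>u\<^sub>e = u\<^sub>p u\<^sub>h u\<^sub>q\<close> lies in the ideal as well.
\<close>

lemma simple_if_simple_corners:
  assumes inverses: "\<And>n. n \<in> Mor G \<Longrightarrow> \<exists>m. inverse_pair n m"
    and connected: "inverse_connected G"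
    and simple: "\<And>e. e \<in> Obj G \<Longrightarrow> simple_ring (corner e)"
  shows "simple_ring R"
  unfolding simple_ring_def
proof (rule notI, elim exE)
  fix I assume nontrivial: "nontrivial_ideal I R"
  then have I: "two_sided_ideal I R" and "I \<noteq> {\<zero>\<^bsub>R\<^esub>}" and "I \<noteq> carrier R"
    by (auto simp: nontrivial_ideal_def)
  interpret I: additive_subgroup I R
    using I by (simp add: two_sided_ideal_def)
  note I_mult = ideal_mult[OF I] and I_carrier = ideal_carrier[OF I]
  obtain f where f: "f \<in> I" "f \<noteq> \<zero>\<^bsub>R\<^esub>"
    using \<open>I \<noteq> {\<zero>\<^bsub>R\<^esub>}\<close> I.zero_closed by blast
  have "supp f \<noteq> {}" using supp_eq_empty I_carrier f by blast
  then obtain n where n: "n \<in> supp f" by blast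
  then have nM: "n \<in> Mor G" using supp_subset by blast
  obtain n' where n': "inverse_pair n n'" using inverses[OF nM] by blast
  note n'' = n'[unfolded inverse_pair_def]
  define h where "h = Cod G n"
  have h: "h \<in> Obj G" using Cod_closed nM by (simp add: h_def)
  have hM: "h \<in> Mor G" "Dom G h = h" "Cod G h = h" using Obj_Mor Dom_Obj Cod_Obj h by auto
  have h_local: "h \<in> local_mor G h" using hM by (simp add: local_mor_def)
  interpret S: skew_monoid_system A "local_category G h" \<sigma> h
    by (rule local_monoid_system[OF h])
  have one_n': "\<one>\<^bsub>B n'\<^esub> \<in> carrier (B n')" using ring_B n'' ring.ring_simprules(6) by blast
  (* The coefficient of f at n becomes the coefficient of y at the identity h. *)
  define y where "y = f \<otimes>\<^bsub>R\<^esub> monomial A G \<one>\<^bsub>B n'\<^esub> n'"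
  have y: "y \<in> I"
    unfolding y_def using n'' one_n' by (intro I_mult f monomial_closed) auto
  have "y h = f n \<otimes>\<^bsub>B n\<^esub> \<sigma> n \<one>\<^bsub>B n'\<^esub>"
  proof -
    have "inverse_pair n' n" using n'' by (simp add: inverse_pair_def)
    moreover have "Comp G h n = n" using Cod_Comp_id[OF nM] by (simp add: h_def)
    ultimately show ?thesis
      unfolding y_def using coeff_mult_monomial[OF I_carrier[OF f(1)] _ one_n', of n h] hM n'' h_def by simp
  qed
  also have "\<dots> = f n"
    using \<sigma>_one[OF nM] n'' monoid.r_one[OF ring.is_monoid[OF ring_B[OF nM]]
      coeff_closed[OF I_carrier[OF f(1)] nM]] by simp
  finally have yh: "y h \<noteq> \<zero>\<^bsub>B h\<^esub>" using n hM by (simp add: supp_def h_def)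

  define K where "K = {z \<in> carrier (corner h). extend h z \<in> I}"
  have "two_sided_ideal K (corner h)"
  proof (rule S.two_sided_idealI)
    fix z x assume z: "z \<in> K" and x: "x \<in> carrier (corner h)"
    show "x \<otimes>\<^bsub>corner h\<^esub> z \<in> K" "z \<otimes>\<^bsub>corner h\<^esub> x \<in> K"
      using z x I_mult[of "extend h z" "extend h x"]
      by (auto simp: K_def extend_mult[OF h] extend_closed[OF h] S.mult_closed)
  qed (auto simp: K_def extend_add[OF h] extend_neg[OF h] extend_zero[OF h] S.add_closed)
  moreover have "truncate h y \<in> K"
    using unit_mult_unit[OF h I_carrier[OF y]] I_mult y unit_closed[OF h] truncate_closed[OF h I_carrier[OF y]]
    by (simp add: K_def flip: unit_mult_unit[OF h I_carrier[OF y]])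
  moreover have "truncate h y \<noteq> \<zero>\<^bsub>corner h\<^esub>"
    using yh h_local coeff_truncate[of h h y] S.coeff_zero[of h] hM by auto
  ultimately have "K = carrier (corner h)"
    using simple[OF h] unfolding simple_ring_def nontrivial_ideal_def by blast
  then have "\<one>\<^bsub>corner h\<^esub> \<in> K" by simp
  then have uh: "unit h \<in> I" using extend_one[OF h] by (simp add: K_def)
  have "unit e \<in> I" if e: "e \<in> Obj G" for e
  proof -
    obtain p q where pq: "p \<in> Mor G" "q \<in> Mor G" "Dom G p = h" "Cod G q = h" "Comp G p q = e"
      using connected e h unfolding inverse_connected_def by blast
    have ce: "Cod G p = e" using Cod_Comp[of p q] pq Cod_Obj[OF e] by simp
    have ones: "\<one>\<^bsub>A e\<^esub> \<in> carrier (A e)" "\<one>\<^bsub>A h\<^esub> \<in> carrier (A h)"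
      using ring_A e h ring.ring_simprules(6) by blast+
    let ?p = "monomial A G \<one>\<^bsub>A e\<^esub> p" and ?q = "monomial A G \<one>\<^bsub>A h\<^esub> q"
    have c: "?p \<in> carrier R" "?q \<in> carrier R" 
      using monomial_closed[OF pq(1), of "\<one>\<^bsub>A e\<^esub>"] monomial_closed[OF pq(2), of "\<one>\<^bsub>A h\<^esub>"] pq ones ce
      by simp_all
    have "?p \<otimes>\<^bsub>R\<^esub> unit h = ?p"
      using monomial_mult_unit[OF h pq(1), of "\<one>\<^bsub>A e\<^esub>"] pq ones ce by simp
    moreover have "?p \<otimes>\<^bsub>R\<^esub> ?q = unit e"
      using monomial_mult[of p q "\<one>\<^bsub>A e\<^esub>" "\<one>\<^bsub>A h\<^esub>"] pq ones ce \<sigma>_one[OF pq(1)]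
        monoid.r_one[OF ring.is_monoid[OF ring_A[OF e]] ones(1)] by simp
    ultimately show ?thesis
      using I_mult(2)[OF I_mult(1)[OF uh c(1)] c(2)] by simp
  qed
  then have "I = carrier R" using ideal_eq_carrier[OF I] by blast
  then show False using \<open>I \<noteq> carrier R\<close> by blast
qed

end


section \<open>The characterization of simplicity\<close>

context skew_category_system
begin

lemma locally_simple_local_category:
  "locally_simple A (local_category G e) \<sigma> e \<longleftrightarrow> locally_simple A G \<sigma> e"
  by (simp add: locally_simple_def local_mor_def)

lemma local_properties_if_simple:
  assumes simple: "simple_ring R" and e: "e \<in> Obj G"
  shows "locally_simple A G \<sigma> e" "field (center_ring (corner e))"
    "kernel_locally_trivial A (local_category G e) \<sigma>"
proof -
  interpret S: skew_monoid_system A "local_category G e" \<sigma> e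
    by (rule local_monoid_system[OF e])
  have corner: "simple_ring (corner e)" by (rule simple_corner_if_simple[OF e simple])
  show "locally_simple A G \<sigma> e"
    using S.locally_simple_if_simple[OF corner] by (simp add: locally_simple_local_category)
  show "field (center_ring (corner e))"
    by (rule field_center_ring_if_simple[OF S.ring_R _ corner])
      (use S.unit_nonzero[OF S.e_Obj] in \<open>simp add: S.one_eq_unit\<close>)
  show "kernel_locally_trivial A (local_category G e) \<sigma>"
    by (rule S.kernel_locally_trivial_if_simple[OF corner])
qed

lemma kernel_locally_trivial_local_category:
  assumes "\<And>e. e \<in> Obj G \<Longrightarrow> kernel_locally_trivial A (local_category G e) \<sigma>"
  shows "kernel_locally_trivial A G \<sigma>"
  unfolding kernel_locally_trivial_def
proof (intro ballI impI)
  fix e m n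
  assume e: "e \<in> Obj G" and mn: "m \<in> local_mor G e" "n \<in> local_mor G e"
    and eq: "\<forall>x\<in>carrier (A e). \<sigma> m x = \<sigma> n x"
  have "local_mor (local_category G e) e = local_mor G e" by (simp add: local_mor_def)
  then show "m = n"
    using assms[OF e] mn eq unfolding kernel_locally_trivial_def by simp
qed

lemma groupoid_inverse_pair:
  assumes "is_groupoid G" "n \<in> Mor G"
  shows "\<exists>m. inverse_pair n m"
proof -
  obtain m where "m \<in> Mor G" "Dom G m = Cod G n" "Cod G m = Dom G n"
    "Comp G m n = Dom G n" "Comp G n m = Cod G n"
    using assms unfolding is_groupoid_def by blast
  then have "inverse_pair n m" using assms(2) by (simp add: inverse_pair_def)
  then show ?thesis by blast
qed

lemma simple_if_locally_abelian_groupoid: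
  assumes groupoid: "is_groupoid G" and abelian: "locally_abelian G"
    and connected: "inverse_connected G"
    and locally_simple: "\<And>e. e \<in> Obj G \<Longrightarrow> locally_simple A G \<sigma> e"
    and center_field: "\<And>e. e \<in> Obj G \<Longrightarrow> field (center_ring (corner e))"
  shows "simple_ring R"
proof (rule simple_if_simple_corners[OF groupoid_inverse_pair[OF groupoid] connected])
  fix e assume e: "e \<in> Obj G"
  interpret S: skew_monoid_system A "local_category G e" \<sigma> e
    by (rule local_monoid_system[OF e])
  show "simple_ring (corner e)"
  proof (rule S.simple_if_abelian_group)
    fix n assume "n \<in> Mor (local_category G e)"
    then have n: "n \<in> local_mor G e" by simp
    obtain m where m: "inverse_pair n m"
      using groupoid_inverse_pair[OF groupoid local_mor_Mor[OF n]] by blast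
    then have "m \<in> local_mor G e"
      using n unfolding inverse_pair_def local_mor_def mem_Collect_eq by metis
    then have "S.inverse_pair n m"
      using m n unfolding S.inverse_pair_def inverse_pair_def local_category_sel by blast
    then show "\<exists>m. S.inverse_pair n m" by blast
  next
    show "Comp (local_category G e) m n = Comp (local_category G e) n m"
      if "m \<in> Mor (local_category G e)" "n \<in> Mor (local_category G e)" for m n
      using abelian e that unfolding locally_abelian_def local_category_sel by blast
    show "locally_simple A (local_category G e) \<sigma> e"
      using locally_simple[OF e] by (simp add: locally_simple_local_category)
    show "field (center_ring (corner e))" by (rule center_field[OF e])
  qed
qed

end

theorem proposition11:
  fixes A :: "'g \<Rightarrow> 'a ring" and G :: "'g category" and \<sigma> :: "'g \<Rightarrow> 'a \<Rightarrow> 'a"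
  assumes "skew_category_system A G \<sigma>"
  shows
    "(simple_ring (skew_category_algebra A G \<sigma>) \<longrightarrow>
        inverse_connected G \<and>
        (\<forall>e\<in>Obj G. locally_simple A G \<sigma> e) \<and>
        (\<forall>e\<in>Obj G. field (center_ring (skew_category_algebra A (local_category G e) \<sigma>))) \<and>
        kernel_locally_trivial A G \<sigma>) \<and>
     (is_groupoid G \<and> locally_abelian G \<longrightarrow>
       (simple_ring (skew_category_algebra A G \<sigma>) \<longleftrightarrow>
        inverse_connected G \<and>
        (\<forall>e\<in>Obj G. locally_simple A G \<sigma> e) \<and>
        (\<forall>e\<in>Obj G. field (center_ring (skew_category_algebra A (local_category G e) \<sigma>))) \<and>
        kernel_locally_trivial A G \<sigma>))"
proof -
  interpret skew_category_system A G \<sigma> by fact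
  have necessary: "inverse_connected G \<and> (\<forall>e\<in>Obj G. locally_simple A G \<sigma> e) \<and>
      (\<forall>e\<in>Obj G. field (center_ring (corner e))) \<and> kernel_locally_trivial A G \<sigma>"
    if "simple_ring R"
    using that inverse_connected_if_simple local_properties_if_simple
      kernel_locally_trivial_local_category by blast
  moreover have "simple_ring R"
    if "is_groupoid G \<and> locally_abelian G" "inverse_connected G"
      "\<forall>e\<in>Obj G. locally_simple A G \<sigma> e" "\<forall>e\<in>Obj G. field (center_ring (corner e))"
    using that simple_if_locally_abelian_groupoid by blast
  ultimately show ?thesis by blast
qed

end
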